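(* Assume that the functions $h_v$ are monotone, DR-submodular, $L_h$-Lipschitz and $\beta_h$-smooth for all $v\in V$, and that $c$ is convex and $L_c$-Lipschitz. For any $\varepsilon,\ell>0$, with probability at least $1-\frac1{n^\ell}$ the algorithm $\mathsf{ProxGrad\text{-}RIS}$ outputs a solution $x\in\mathcal P$ that is a $(\frac12-\varepsilon)$-approximation of the optimal value of CIM-BS, i.e. $(g+s)(x)\ge(\frac12-\varepsilon)\,\mathrm{OPT}_{g+s}$, where $\mathrm{OPT}_{g+s}=\max_{y\in\mathcal P}(g+s)(y)$.
   Context: Model (CIM-BS). $G=(V,E)$ is a directed graph, $n=|V|$, $m=|E|$. In the triggering model each $v\in V$ has a distribution $D_v$ on subsets of its in-neighbours $N^-(v)$; each $v$ independently samples $T_v\sim D_v$. Given a seed set $S$, the nodes of $S$ are active at time $0$; active nodes stay active; at time $t\ge1$ a node $v$ becomes active if some node of $T_v$ is active at time $t-1$. $\sigma(S)$ is the expected final number of active nodes. $\mathcal D\subseteq\mathbb R_{\ge0}^d$ is a convex set of strategy mixes, and $h_v:\mathbb R_{\ge 0}^d\to[0,1]$ ($v\in V$) are the strategy activation functions. Put $g(x)=\sum_{S\subseteq V}\sigma(S)\prod_{u\in S}h_u(x)\prod_{v\notin S}(1-h_v(x))$. $c$ is the cost function, $k$ the budget, $\lambda\ge0$, $s(x)=\lambda(k-c(x))$, $\mathcal P=\{x\in\mathcal D:c(x)\le k\}$, and $\Delta\ge\max_{x,y\in\mathcal P}\|x-y\|_2$. CIM-BS is the problem of maximizing $g+s$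 over $\mathcal P$. Monotone means coordinatewise non-decreasing; $f$ is DR-submodular if $f(x+\delta e_i)-f(x)\ge f(y+\delta e_i)-f(y)$ for $x\le y$, $\delta>0$, $e_i$ a standard unit vector; $L$-Lipschitz and $\beta$-smooth (i.e. $\beta$-Lipschitz gradient) are with respect to the $2$-norm. RR sets. A (random) reverse reachable (RR) set: pick a root $v\in V$ uniformly at random, sample all $T_u$ ($u\in V$), and let $R$ be the set of nodes that can reach $v$ in the graph on $V$ with edges $\{(w,u):u\in V,w\in T_u\}$. For a sequence $\mathcal R$ of $\theta$ independent RR sets, $\hat g_{\mathcal R}(x)=\frac n\theta\sum_{R\in\mathcal R}\bigl(1-\prod_{v\in R}(1-h_v(x))\bigr)$, $\nu^{(1)}(\mathcal R)=\frac1\theta\sum_{R\in\mathcal R}|R|$, $\nu^{(2)}(\mathcal R)=\frac1\theta\sum_{R\in\mathcal R}|R|^2$. Covering number. A finite set $N$ is an $\epsilon$-net of $\mathcal P$ if every $x\in\mathcal P$ has some $\pi(x)\in N$ with $\|x-\pi(x)\|_2\le\epsilon$; $\mathcal N(\mathcal P,\epsilon)$ is the least cardinality of an $\epsilon$-net. Inner gradient algorithm $\mathcal A(\mathcal R)$. With $\beta=\nu^{(1)}(\mathcal R)n\beta_h+\nu^{(2)}(\mathcal R)nL_h^2$, run $T=3\beta\Delta^2/(4\varepsilon)$ (rounded up) steps of $x^{(t+1)}=\mathrm{prox}_{-\eta s}(x^{(t)}+\eta\nabla\hat g_{\mathcal R}(x^{(t)}))$ with $\eta=1/\beta$ from any $x^{(0)}\in\mathcal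 P$, where $\mathrm{prox}_\phi(x)=\arg\min_{y\in\mathcal P}(\phi(y)+\frac12\|x-y\|_2^2)$, and return the iterate $x^{(t)}$ with the largest value of $\hat g_{\mathcal R}+s$. Algorithm $\mathsf{ProxGrad\text{-}RIS}$. Let $\alpha=\frac12$ and $L_1=L_2=n^2L_h+\lambda L_c$. Set $LB=1$, $\mathcal R_0=\emptyset$, $\theta_0=0$, $\varepsilon'=\sqrt2\,\varepsilon/3$. For $i=1,2,\dots,\lfloor\log_2(n+\lambda k)-1\rfloor$: let $x_i=(n+\lambda k)/2^i$ and $\theta_i=\Bigl\lceil n(2+\tfrac23\varepsilon')\frac{\ln\mathcal N(\mathcal P,\frac{\varepsilon/3}{L_2}x_i)+\ell\ln n+\ln2+\ln\log_2(n+\lambda k)}{\varepsilon'^2x_i}\Bigr\rceil$; add $\theta_i-\theta_{i-1}$ new independent RR sets to $\mathcal R_{i-1}$ to form $\mathcal R_i$; let $y_i=\mathcal A(\mathcal R_i)$; if $(\hat g_{\mathcal R_i}+s)(y_i)\ge(1+\varepsilon'+\varepsilon/3)x_i$, set $LB=\frac{(\hat g_{\mathcal R_i}+s)(y_i)}{1+\varepsilon'+\varepsilon/3}$ and leave the loop. Then put $\theta^{(1)}=\frac{8n\ln(4n^\ell)}{LB\,(\alpha-\varepsilon/3)^2\varepsilon^2/9}$, $\theta^{(2)}=\frac{2\alpha' n\ln\left(4n^\ell\mathcal N(\mathcal P,\frac{\varepsilon/3}{L_1+L_2}LB)\right)}{\left(\varepsilon/3-\frac14(\alpha-\varepsilon/3)^2\varepsilon/3\right)^2LB}$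 with $\alpha'=\alpha-\varepsilon/3$, and $\tilde\theta=\max\{\theta^{(1)},\theta^{(2)}\}$ (rounded up); generate a fresh sequence $\mathcal R$ of $\tilde\theta$ independent RR sets, and output $x=\mathcal A(\mathcal R)$.
   Formalization: The formal theorem additionally assumes OPT_{g+s} ≥ 1 (so that LB = 1 is a valid initial lower bound; the claim fails for small OPT) and that L_h or β_h is positive (so that the step size η = 1/β is defined). *)

theory Defs
  imports "HOL-Probability.Probability"
begin

section \<open>Triggering model and influence spread\<close>

text \<open>
  The node set is the finite type \<open>'v\<close>, so \<open>n = CARD('v)\<close>.  \<open>Tr v\<close> is the triggering
  distribution of \<open>v\<close>; a sample of all triggering sets is a function \<open>T :: 'v \<Rightarrow> 'v set\<close>.
\<close>

definition triggering_sets :: "('v::finite \<Rightarrow> 'v set pmf) \<Rightarrow> ('v \<Rightarrow> 'v set) pmf" where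
  "triggering_sets Tr = Pi_pmf UNIV {} Tr"

primrec active_at :: "('v \<Rightarrow> 'v set) \<Rightarrow> 'v set \<Rightarrow> nat \<Rightarrow> 'v set" where
  "active_at T S 0 = S"
| "active_at T S (Suc t) = active_at T S t \<union> {v. T v \<inter> active_at T S t \<noteq> {}}"

definition final_active :: "('v \<Rightarrow> 'v set) \<Rightarrow> 'v set \<Rightarrow> 'v set" where
  "final_active T S = (\<Union>t. active_at T S t)"

definition spread :: "('v::finite \<Rightarrow> 'v set pmf) \<Rightarrow> 'v set \<Rightarrow> real" where
  "spread Tr S = measure_pmf.expectation (triggering_sets Tr) (\<lambda>T. real (card (final_active T S)))"


section \<open>Functions on the nonnegative orthant\<close>

text \<open>
  The order on \<open>real ^ 'd\<close> is componentwise, so \<open>{0..}\<close> is the nonnegative orthant.  Gradients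
  are taken relative to it, since the activation functions are only given there; every point of
  the orthant, including boundary points, admits at most one gradient in this sense.
\<close>

definition grad :: "(real ^ 'd \<Rightarrow> real) \<Rightarrow> real ^ 'd \<Rightarrow> real ^ 'd" where
  "grad f x = (THE G. (f has_derivative (\<lambda>z. G \<bullet> z)) (at x within {0..}))"

definition smooth :: "real \<Rightarrow> (real ^ 'd \<Rightarrow> real) \<Rightarrow> bool" where
  "smooth \<beta> f \<longleftrightarrow> f differentiable_on {0..} \<and> \<beta>-lipschitz_on {0..} (grad f)"

definition dr_submodular :: "(real ^ 'd \<Rightarrow> real) \<Rightarrow> bool" where
  "dr_submodular f \<longleftrightarrow>
     (\<forall>x y i \<delta>. 0 \<le> x \<longrightarrow> x \<le> y \<longrightarrow> 0 < \<delta> \<longrightarrow>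
        f (y + \<delta> *\<^sub>R axis i 1) - f y \<le> f (x + \<delta> *\<^sub>R axis i 1) - f x)"


section \<open>The problem CIM-BS\<close>

definition cim_g ::
  "('v::finite \<Rightarrow> 'v set pmf) \<Rightarrow> ('v \<Rightarrow> real ^ 'd \<Rightarrow> real) \<Rightarrow> real ^ 'd \<Rightarrow> real" where
  "cim_g Tr h x = (\<Sum>S\<in>UNIV. spread Tr S * (\<Prod>u\<in>S. h u x) * (\<Prod>v\<in>-S. 1 - h v x))"

definition cim_s :: "real \<Rightarrow> real \<Rightarrow> (real ^ 'd \<Rightarrow> real) \<Rightarrow> real ^ 'd \<Rightarrow> real" where
  "cim_s lam k c x = lam * (k - c x)"

definition feasible :: "(real ^ 'd) set \<Rightarrow> (real ^ 'd \<Rightarrow> real) \<Rightarrow> real \<Rightarrow> (real ^ 'd) set" where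
  "feasible D c k = {x \<in> D. c x \<le> k}"

definition cim_opt :: "(real ^ 'd) set \<Rightarrow> (real ^ 'd \<Rightarrow> real) \<Rightarrow> real" where
  "cim_opt P F = (SUP y\<in>P. F y)"


section \<open>Reverse reachable sets\<close>

definition rr_set :: "('v::finite \<Rightarrow> 'v set pmf) \<Rightarrow> 'v set pmf" where
  "rr_set Tr =
     do { v \<leftarrow> pmf_of_set UNIV;
          T \<leftarrow> triggering_sets Tr;
          return_pmf {w. (w, v) \<in> {(w', u). w' \<in> T u}\<^sup>*} }"

definition ghat :: "('v::finite \<Rightarrow> real ^ 'd \<Rightarrow> real) \<Rightarrow> 'v set list \<Rightarrow> real ^ 'd \<Rightarrow> real" where
  "ghat h Rs x = real CARD('v) / real (length Rs) * (\<Sum>R\<leftarrow>Rs. 1 - (\<Prod>v\<in>R. 1 - h v x))"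

definition rr_moment :: "nat \<Rightarrow> 'v set list \<Rightarrow> real" where
  "rr_moment j Rs = (\<Sum>R\<leftarrow>Rs. real (card R) ^ j) / real (length Rs)"


section \<open>Covering numbers\<close>

text \<open>The points of a net are not required to lie in \<open>P\<close>.\<close>

definition is_net :: "real \<Rightarrow> (real ^ 'd) set \<Rightarrow> (real ^ 'd) set \<Rightarrow> bool" where
  "is_net r P N \<longleftrightarrow> finite N \<and> (\<forall>x\<in>P. \<exists>p\<in>N. norm (x - p) \<le> r)"

definition covering_number :: "(real ^ 'd) set \<Rightarrow> real \<Rightarrow> nat" where
  "covering_number P r = (LEAST m. \<exists>N. is_net r P N \<and> card N = m)"


section \<open>The inner proximal gradient algorithm\<close>

definition is_prox ::
  "(real ^ 'd) set \<Rightarrow> (real ^ 'd \<Rightarrow> real) \<Rightarrow> real ^ 'd \<Rightarrow> real ^ 'd \<Rightarrow> bool" where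
  "is_prox P \<phi> x z \<longleftrightarrow> is_arg_min (\<lambda>y. \<phi> y + (norm (x - y))\<^sup>2 / 2) (\<lambda>y. y \<in> P) z"

definition inner_beta :: "real \<Rightarrow> real \<Rightarrow> 'v::finite set list \<Rightarrow> real" where
  "inner_beta Lh \<beta>h Rs =
     rr_moment 1 Rs * real CARD('v) * \<beta>h + rr_moment 2 Rs * real CARD('v) * Lh\<^sup>2"

text \<open>
  \<open>inner_result P s h Lh \<beta>h \<Delta> \<epsilon> Rs y\<close>: the point \<open>y\<close> can be returned by the inner algorithm on
  the sequence \<open>Rs\<close>.  It is a relation because the starting point, and the choice among
  equally good iterates, are left open.
\<close>

definition inner_result ::
  "(real ^ 'd) set \<Rightarrow> (real ^ 'd \<Rightarrow> real) \<Rightarrow> ('v::finite \<Rightarrow> real ^ 'd \<Rightarrow> real) \<Rightarrow>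
   real \<Rightarrow> real \<Rightarrow> real \<Rightarrow> real \<Rightarrow> 'v set list \<Rightarrow> real ^ 'd \<Rightarrow> bool" where
  "inner_result P s h Lh \<beta>h \<Delta> \<epsilon> Rs y \<longleftrightarrow>
     (let \<beta> = inner_beta Lh \<beta>h Rs;
          \<eta> = 1 / \<beta>;
          T = nat \<lceil>3 * \<beta> * \<Delta>\<^sup>2 / (4 * \<epsilon>)\<rceil>
      in \<exists>x. x 0 \<in> P \<and>
             (\<forall>t<T. is_prox P (\<lambda>z. - \<eta> * s z) (x t + \<eta> *\<^sub>R grad (ghat h Rs) (x t)) (x (Suc t))) \<and>
             (\<exists>t. is_arg_max (\<lambda>t. ghat h Rs (x t) + s (x t)) (\<lambda>t. t \<le> T) t \<and> y = x t))"


section \<open>The algorithm ProxGrad-RIS\<close>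

text \<open>
  \<open>search rr A Fhat \<theta> \<xi> \<kappa> i j Rs\<close> performs the iterations \<open>i, \<dots>, i + j - 1\<close> of the search for
  the lower bound \<open>LB\<close>, where \<open>Rs\<close> are the RR sets collected so far, \<open>\<xi> i\<close> is the \<open>i\<close>-th guess
  and \<open>\<kappa>\<close> the factor in the stopping test.
\<close>

primrec search ::
  "'v set pmf \<Rightarrow> ('v set list \<Rightarrow> real ^ 'd) \<Rightarrow> ('v set list \<Rightarrow> real ^ 'd \<Rightarrow> real) \<Rightarrow>
   (nat \<Rightarrow> nat) \<Rightarrow> (nat \<Rightarrow> real) \<Rightarrow> real \<Rightarrow> nat \<Rightarrow> nat \<Rightarrow> 'v set list \<Rightarrow> real pmf"
where
  "search rr A Fhat \<theta> \<xi> \<kappa> i 0 Rs = return_pmf 1"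
| "search rr A Fhat \<theta> \<xi> \<kappa> i (Suc j) Rs =
     do { new \<leftarrow> replicate_pmf (\<theta> i - \<theta> (i - 1)) rr;
          let Rs' = Rs @ new;
          let val = Fhat Rs' (A Rs');
          if val \<ge> \<kappa> * \<xi> i then return_pmf (val / \<kappa>)
          else search rr A Fhat \<theta> \<xi> \<kappa> (Suc i) j Rs' }"

definition search_size ::
  "real \<Rightarrow> (real ^ 'd) set \<Rightarrow> real \<Rightarrow> real \<Rightarrow> real \<Rightarrow> real \<Rightarrow> nat \<Rightarrow> nat" where
  "search_size n P L2 B \<epsilon> l i =
     (if i = 0 then 0 else
      let \<epsilon>' = sqrt 2 * \<epsilon> / 3; xi = B / 2 ^ i
      in nat \<lceil>n * (2 + 2 / 3 * \<epsilon>') *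
               (ln (real (covering_number P ((\<epsilon> / 3) / L2 * xi))) + l * ln n + ln 2 + ln (log 2 B))
               / (\<epsilon>'\<^sup>2 * xi)\<rceil>)"

definition final_size ::
  "real \<Rightarrow> (real ^ 'd) set \<Rightarrow> real \<Rightarrow> real \<Rightarrow> real \<Rightarrow> real \<Rightarrow> real \<Rightarrow> nat" where
  "final_size n P L1 L2 \<epsilon> l LB =
     (let \<alpha> = 1 / 2;
          \<alpha>' = \<alpha> - \<epsilon> / 3;
          \<theta>1 = 8 * n * ln (4 * n powr l) / (LB * (\<alpha> - \<epsilon> / 3)\<^sup>2 * (\<epsilon>\<^sup>2 / 9));
          \<theta>2 = 2 * \<alpha>' * n *
                 ln (4 * n powr l * real (covering_number P ((\<epsilon> / 3) / (L1 + L2) * LB)))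
               / ((\<epsilon> / 3 - 1 / 4 * (\<alpha> - \<epsilon> / 3)\<^sup>2 * (\<epsilon> / 3))\<^sup>2 * LB)
      in nat \<lceil>max \<theta>1 \<theta>2\<rceil>)"

text \<open>The distribution of the output, for a given implementation \<open>A\<close> of the inner algorithm.\<close>

definition prox_grad_ris ::
  "('v::finite \<Rightarrow> 'v set pmf) \<Rightarrow> ('v \<Rightarrow> real ^ 'd \<Rightarrow> real) \<Rightarrow> (real ^ 'd) set \<Rightarrow>
   (real ^ 'd \<Rightarrow> real) \<Rightarrow> real \<Rightarrow> real \<Rightarrow> real \<Rightarrow> real \<Rightarrow> real \<Rightarrow> real \<Rightarrow>
   ('v set list \<Rightarrow> real ^ 'd) \<Rightarrow> (real ^ 'd) pmf" where
  "prox_grad_ris Tr h D c k lam Lh Lc \<epsilon> l A =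
     (let n = real CARD('v);
          P = feasible D c k;
          B = n + lam * k;
          L1 = n\<^sup>2 * Lh + lam * Lc;
          L2 = n\<^sup>2 * Lh + lam * Lc;
          \<kappa> = 1 + sqrt 2 * \<epsilon> / 3 + \<epsilon> / 3;
          Fhat = (\<lambda>Rs x. ghat h Rs x + cim_s lam k c x)
      in do { LB \<leftarrow> search (rr_set Tr) A Fhat (search_size n P L2 B \<epsilon> l) (\<lambda>i. B / 2 ^ i) \<kappa>
                      1 (nat \<lfloor>log 2 B - 1\<rfloor>) [];
              Rs \<leftarrow> replicate_pmf (final_size n P L1 L2 \<epsilon> l LB) (rr_set Tr);
              return_pmf (A Rs) })"

end

theory Submission
  imports Defs
begin

text \<open>
  Write \<open>g = n \<cdot> E[Z\<^sub>R]\<close> with \<open>Z\<^sub>R x = 1 - (\<Prod>v\<in>R. 1 - h v x)\<close>, so that \<open>ghat\<close> is an empirical mean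
  of variables in \<open>[0, n]\<close>.  Each \<open>Z\<^sub>R\<close> is monotone, DR-submodular, Lipschitz and smooth, whence
  \<open>\<nabla>ghat x \<bullet> (y - x) \<ge> ghat y - 2 ghat x\<close> and the proximal gradient steps reach half of the
  empirical optimum up to \<open>\<epsilon>/3\<close>.  Chernoff bounds and a union bound over a net of \<open>P\<close> show that
  \<open>LB \<le> OPT\<close> except with probability \<open>1 / (2 n^l)\<close>, and, given this, that the final sample transfers the
  guarantee from \<open>ghat + s\<close> to \<open>g + s\<close> with the same failure probability.

  Bounding the Lipschitz constant of \<open>ghat - g\<close> by \<open>2 n^2 Lh\<close> does not suffice for the
  prescribed sample sizes.  As both functions are monotone, \<open>sqrt 2 n^2 Lh\<close> is a valid constant, and the gain
  covers the loss in the other estimates.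
\<close>

text \<open>Of the search only \<open>0 < LB\<close> and \<open>LB \<le> OPT\<close> matter: the
  final sample size and the final net radius are calibrated to \<open>LB\<close>, and a smaller
  \<open>LB\<close> gives a larger sample and a finer net. \<open>P\<close> need not be closed. So
  \<open>OPT\<close> is a supremum that is only approached, and projected net points lie in
  \<open>closure P\<close>, where nothing is known about \<open>s\<close>, since \<open>c\<close> is
  controlled on \<open>D\<close> alone. All deviation events are therefore stated for
  \<open>g\<close> and \<open>ghat\<close>, and \<open>s\<close> is evaluated at points of
  \<open>P\<close> only. In the final round a bad output has \<open>g\<close> below about half of
  \<open>OPT\<close>, so the union bound runs only over net points whose \<open>g\<close> is that
  small. This halves the variance term of the tail bound and accounts for the factor
  \<open>\<alpha>'\<close> in the second sample size. The error budget is tight: after all other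
  losses the deviation left at a net point exceeds \<epsilon>/3 times \<open>OPT\<close> by a narrow
  margin, and this is where the constant \<open>sqrt 2\<close> decides.\<close>

section \<open>Tail bounds for independent samples\<close>

text \<open>With the denominator cleared, the difference \<open>f\<close> of the two sides vanishes
  at 0 and has derivative \<open>f'\<close>; this vanishes at 0 as well and is nondecreasing because
  \<open>(1 - z) * exp z \<le> 1\<close>.\<close>

lemma exp_minus_one_minus_le_bernstein:
  fixes x :: real
  assumes "0 \<le> x" "x < 3"
  shows "exp x - 1 - x \<le> x\<^sup>2 / 2 / (1 - x / 3)"
proof -
  define f' where "f' \<equiv> \<lambda>x::real. x + 2 + (x - 2) * exp x"
  define f where "f \<equiv> \<lambda>x::real. 3 * x\<^sup>2 / 2 - (3 - x) * (exp x - 1 - x)"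
  have f'_nonneg: "0 \<le> f' y" if "0 \<le> y" for y
  proof -
    have "f' 0 \<le> f' y"
    proof (rule DERIV_nonneg_imp_nondecreasing[OF that])
      fix z :: real
      have "(f' has_real_derivative 1 + (z - 1) * exp z) (at z)"
        unfolding f'_def by (auto intro!: derivative_eq_intros simp: algebra_simps)
      moreover have "(1 - z) * exp z \<le> 1"
        using mult_right_mono[OF exp_ge_add_one_self[of "- z"], of "exp z"] by (simp add: exp_minus)
      ultimately show "\<exists>d. (f' has_real_derivative d) (at z) \<and> 0 \<le> d"
        by (intro exI[of _ "1 + (z - 1) * exp z"]) (auto simp: algebra_simps)
    qed
    thus ?thesis by (simp add: f'_def)
  qed
  have "f 0 \<le> f x"
  proof (rule DERIV_nonneg_imp_nondecreasing[OF assms(1)])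
    fix z :: real assume "0 \<le> z"
    moreover have "(f has_real_derivative f' z) (at z)"
      unfolding f_def f'_def by (auto intro!: derivative_eq_intros simp: algebra_simps)
    ultimately show "\<exists>d. (f has_real_derivative d) (at z) \<and> 0 \<le> d"
      using f'_nonneg by blast
  qed
  hence "(3 - x) * (exp x - 1 - x) \<le> 3 * x\<^sup>2 / 2"
    by (simp add: f_def)
  with assms show ?thesis by (simp add: field_simps)
qed

lemma exp_uminus_le_quadratic:
  fixes x :: real
  assumes "0 \<le> x"
  shows "exp (- x) - 1 + x \<le> x\<^sup>2 / 2"
proof -
  define f where "f \<equiv> \<lambda>x::real. x\<^sup>2 / 2 - exp (- x) + 1 - x"
  have "f 0 \<le> f x"
  proof (rule DERIV_nonneg_imp_nondecreasing[OF assms])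
    fix z :: real
    have "(f has_real_derivative z + exp (- z) - 1) (at z)"
      unfolding f_def by (auto intro!: derivative_eq_intros)
    moreover have "0 \<le> z + exp (- z) - 1" using exp_ge_add_one_self[of "- z"] by simp
    ultimately show "\<exists>d. (f has_real_derivative d) (at z) \<and> 0 \<le> d" by blast
  qed
  thus ?thesis by (simp add: f_def)
qed

text \<open>Convexity puts the exponential below its chord over [0, 1], so only the mean of
  \<open>Z\<close> survives; \<open>1 + u \<le> exp u\<close> then yields the moment generating
  function of a Poisson variable with that mean. The sign of \<open>a\<close> is free, which serves
  both tails.\<close>

lemma expectation_exp_le:
  fixes p :: "'a pmf" and Z :: "'a \<Rightarrow> real" and a :: real
  assumes Z: "\<And>x. x \<in> set_pmf p \<Longrightarrow> Z x \<in> {0..1}"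
  shows "(\<integral>\<^sup>+x. ennreal (exp (a * Z x)) \<partial>measure_pmf p)
           \<le> ennreal (exp (measure_pmf.expectation p Z * (exp a - 1)))"
proof -
  have int: "integrable (measure_pmf p) Z"
    by (rule measure_pmf.integrable_const_bound[where B = 1]) (use Z in \<open>auto simp: AE_measure_pmf_iff\<close>)
  have le: "exp (a * Z x) \<le> 1 + Z x * (exp a - 1)" if "x \<in> set_pmf p" for x
    using convex_onD[OF exp_convex, of "Z x" 0 a] Z[OF that]
    by (auto simp: algebra_simps)
  have "(\<integral>\<^sup>+x. ennreal (exp (a * Z x)) \<partial>measure_pmf p)
          \<le> (\<integral>\<^sup>+x. ennreal (1 + Z x * (exp a - 1)) \<partial>measure_pmf p)"
    by (intro nn_integral_mono_AE) (use le in \<open>auto simp: AE_measure_pmf_iff intro!: ennreal_leI\<close>)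
  also have "\<dots> = ennreal (\<integral>x. 1 + Z x * (exp a - 1) \<partial>measure_pmf p)"
    by (intro nn_integral_eq_integral)
       (use int le order.trans[OF less_imp_le[OF exp_gt_zero]] in \<open>auto simp: AE_measure_pmf_iff\<close>)
  also have "(\<integral>x. 1 + Z x * (exp a - 1) \<partial>measure_pmf p)
               = 1 + measure_pmf.expectation p Z * (exp a - 1)"
    using int by simp
  also have "ennreal \<dots> \<le> ennreal (exp (measure_pmf.expectation p Z * (exp a - 1)))"
    by (intro ennreal_leI) (rule exp_ge_add_one_self)
  finally show ?thesis .
qed

lemma nn_integral_replicate_pmf_exp:
  "(\<integral>\<^sup>+xs. ennreal (exp (a * (\<Sum>x\<leftarrow>xs. Z x))) \<partial>measure_pmf (replicate_pmf N p))
     = (\<integral>\<^sup>+x. ennreal (exp (a * Z x)) \<partial>measure_pmf p) ^ N"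
proof (induction N)
  case (Suc N)
  have "(\<integral>\<^sup>+xs. ennreal (exp (a * (\<Sum>x\<leftarrow>xs. Z x))) \<partial>measure_pmf (replicate_pmf (Suc N) p))
    = (\<integral>\<^sup>+x. \<integral>\<^sup>+xs. ennreal (exp (a * Z x)) * ennreal (exp (a * (\<Sum>x\<leftarrow>xs. Z x)))
          \<partial>measure_pmf (replicate_pmf N p) \<partial>measure_pmf p)"
    by (simp add: distrib_left exp_add ennreal_mult)
  also have "\<dots> = (\<integral>\<^sup>+x. ennreal (exp (a * Z x)) \<partial>measure_pmf p) ^ Suc N"
    by (simp add: nn_integral_cmult nn_integral_multc Suc.IH)
  finally show ?case .
qed simp

text \<open>Exponential Markov inequality. The factor \<open>a\<close> stays inside the event, so
  that a negative \<open>a\<close> gives the lower tail.\<close>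

lemma replicate_pmf_chernoff:
  fixes p :: "'a pmf" and Z :: "'a \<Rightarrow> real" and a b :: real
  assumes Z: "\<And>x. x \<in> set_pmf p \<Longrightarrow> Z x \<in> {0..1}"
  shows "measure_pmf.prob (replicate_pmf N p) {xs. a * (\<Sum>x\<leftarrow>xs. Z x) \<ge> real N * b}
           \<le> exp (real N * (measure_pmf.expectation p Z * (exp a - 1) - b))"
proof -
  let ?M = "measure_pmf (replicate_pmf N p)" and ?m = "measure_pmf.expectation p Z"
  have "emeasure ?M {xs. a * (\<Sum>x\<leftarrow>xs. Z x) \<ge> real N * b}
    = emeasure ?M {xs \<in> space ?M. 1 \<le> ennreal (exp (- (real N * b))) * ennreal (exp (a * (\<Sum>x\<leftarrow>xs. Z x)))}"
    by (intro arg_cong2[where f = emeasure] refl)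
       (auto simp: ennreal_mult[symmetric] exp_add[symmetric] ennreal_1[symmetric] simp del: ennreal_1)
  also have "\<dots> \<le> ennreal (exp (- (real N * b)))
      * (\<integral>\<^sup>+xs. ennreal (exp (a * (\<Sum>x\<leftarrow>xs. Z x))) * indicator UNIV xs \<partial>?M)"
    using nn_integral_Markov_inequality[of "\<lambda>xs. ennreal (exp (a * (\<Sum>x\<leftarrow>xs. Z x)))" UNIV ?M]
    by simp
  also have "\<dots> = ennreal (exp (- (real N * b))) * (\<integral>\<^sup>+x. ennreal (exp (a * Z x)) \<partial>measure_pmf p) ^ N"
    by (simp add: nn_integral_replicate_pmf_exp)
  also have "\<dots> \<le> ennreal (exp (- (real N * b))) * ennreal (exp (?m * (exp a - 1))) ^ N"
    by (intro mult_left_mono power_mono expectation_exp_le Z) auto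
  also have "\<dots> = ennreal (exp (real N * (?m * (exp a - 1) - b)))"
    by (simp add: ennreal_power ennreal_mult[symmetric] exp_of_nat_mult[symmetric] exp_add[symmetric]
        algebra_simps)
  finally show ?thesis
    by (simp add: measure_pmf.emeasure_eq_measure)
qed

text \<open>The exponent contains an upper bound \<open>q\<close> instead of the mean, because at a
  net point only a bound on \<open>g\<close> is available.\<close>

lemma replicate_pmf_upper_tail:
  fixes p :: "'a pmf" and Z :: "'a \<Rightarrow> real"
  assumes Z: "\<And>x. x \<in> set_pmf p \<Longrightarrow> Z x \<in> {0..1}"
    and mean: "measure_pmf.expectation p Z \<le> q" and "0 < q" and "0 \<le> t"
  shows "measure_pmf.prob (replicate_pmf N p)
           {xs. (\<Sum>x\<leftarrow>xs. Z x) \<ge> real N * (measure_pmf.expectation p Z + t)}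
         \<le> exp (- (real N * t\<^sup>2 / (2 * q + 2 * t / 3)))"
proof -
  define m where "m = measure_pmf.expectation p Z"
  \<comment> \<open>Bernstein's choice: it makes \<open>1 - a / 3\<close> equal to
    \<open>q / (q + t / 3)\<close>, so that the second-order term comes out as half of
    \<open>a * t\<close>.\<close>
  define a where "a = t / (q + t / 3)"
  have a: "0 \<le> a" "a < 3" using assms(3,4) by (auto simp: a_def field_simps)
  have "measure_pmf.prob (replicate_pmf N p) {xs. (\<Sum>x\<leftarrow>xs. Z x) \<ge> real N * (m + t)}
      \<le> measure_pmf.prob (replicate_pmf N p) {xs. a * (\<Sum>x\<leftarrow>xs. Z x) \<ge> real N * (a * (m + t))}"
    using mult_left_mono[OF _ a(1)]
    by (intro measure_pmf.finite_measure_mono) (auto simp: mult.left_commute)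
  also have "\<dots> \<le> exp (real N * (m * (exp a - 1) - a * (m + t)))"
    using replicate_pmf_chernoff[of p Z, OF Z] by (simp add: m_def)
  also have "m * (exp a - 1) - a * (m + t) \<le> - (t\<^sup>2 / (2 * q + 2 * t / 3))"
  proof -
    have ea: "0 \<le> exp a - 1 - a" using exp_ge_add_one_self[of a] by linarith
    have "m * (exp a - 1 - a) \<le> q * (a\<^sup>2 / 2 / (1 - a / 3))"
      using ea mean assms(3)
      by (intro order.trans[OF mult_right_mono mult_left_mono]
          exp_minus_one_minus_le_bernstein a) (auto simp: m_def)
    also have "1 - a / 3 = q / (q + t / 3)" using assms(3,4) by (simp add: a_def field_simps)
    also have "q * (a\<^sup>2 / 2 / (q / (q + t / 3))) = t\<^sup>2 / (2 * (q + t / 3))"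
      using assms(3,4) by (simp add: a_def power2_eq_square)
    finally have "m * (exp a - 1 - a) \<le> t\<^sup>2 / (2 * (q + t / 3))" .
    moreover have "a * t = 2 * (t\<^sup>2 / (2 * (q + t / 3)))"
      unfolding a_def power2_eq_square using assms(3,4) by (simp add: divide_simps)
    ultimately show ?thesis by (simp add: algebra_simps)
  qed
  finally show ?thesis by (simp add: m_def mult_left_mono)
qed

lemma replicate_pmf_lower_tail:
  fixes p :: "'a pmf" and Z :: "'a \<Rightarrow> real"
  assumes Z: "\<And>x. x \<in> set_pmf p \<Longrightarrow> Z x \<in> {0..1}"
    and mean: "measure_pmf.expectation p Z \<le> q" and "0 < q" and "0 \<le> t"
  shows "measure_pmf.prob (replicate_pmf N p)
           {xs. (\<Sum>x\<leftarrow>xs. Z x) \<le> real N * (measure_pmf.expectation p Z - t)}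
         \<le> exp (- (real N * t\<^sup>2 / (2 * q)))"
proof -
  define m where "m = measure_pmf.expectation p Z"
  \<comment> \<open>The minimiser of \<open>q * a\<^sup>2 / 2 - a * t\<close>.\<close>
  define a where "a = t / q"
  have a: "0 \<le> a" using assms(3,4) by (auto simp: a_def)
  have "measure_pmf.prob (replicate_pmf N p) {xs. (\<Sum>x\<leftarrow>xs. Z x) \<le> real N * (m - t)}
      \<le> measure_pmf.prob (replicate_pmf N p) {xs. - a * (\<Sum>x\<leftarrow>xs. Z x) \<ge> real N * (- a * (m - t))}"
    using mult_left_mono[OF _ a]
    by (intro measure_pmf.finite_measure_mono) (auto simp: mult.left_commute)
  also have "\<dots> \<le> exp (real N * (m * (exp (- a) - 1) - (- a * (m - t))))"
    using replicate_pmf_chernoff[of p Z, OF Z] unfolding m_def by blast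
  also have "m * (exp (- a) - 1) - (- a * (m - t)) \<le> - (t\<^sup>2 / (2 * q))"
  proof -
    have ea: "0 \<le> exp (- a) - 1 + a" using exp_ge_add_one_self[of "- a"] by linarith
    have "m * (exp (- a) - 1 + a) \<le> q * (a\<^sup>2 / 2)"
      using ea mean assms(3)
      by (intro order.trans[OF mult_right_mono mult_left_mono] exp_uminus_le_quadratic a)
         (auto simp: m_def)
    moreover have "q * (a\<^sup>2 / 2) = t\<^sup>2 / (2 * q)" "a * t = 2 * (t\<^sup>2 / (2 * q))"
      using assms(3) by (simp_all add: a_def power2_eq_square)
    ultimately show ?thesis by (simp add: algebra_simps)
  qed
  finally show ?thesis by (simp add: m_def mult_left_mono)
qed

section \<open>Failure probabilities of composed random computations\<close>

lemma prob_bind_pmf: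
  "measure_pmf.prob (bind_pmf M f) B = measure_pmf.expectation M (\<lambda>x. measure_pmf.prob (f x) B)"
proof -
  have "ennreal (measure_pmf.prob (bind_pmf M f) B)
      = (\<integral>\<^sup>+x. ennreal (measure_pmf.prob (f x) B) \<partial>measure_pmf M)"
    by (simp add: measure_pmf.emeasure_eq_measure[symmetric])
  also have "\<dots> = ennreal (measure_pmf.expectation M (\<lambda>x. measure_pmf.prob (f x) B))"
    by (intro nn_integral_eq_integral measure_pmf.integrable_const_bound[where B = 1]) auto
  finally show ?thesis by (simp add: integral_nonneg_AE)
qed

text \<open>A union bound across a bind: outside \<open>C\<close> the continuation \<open>f\<close>
  is compared with \<open>f'\<close>. In the search, \<open>f'\<close> continues regardless of the
  stopping test and \<open>d = 0\<close>; in the theorem, \<open>B'\<close> is empty and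
  \<open>d\<close> is the failure probability of the final round.\<close>

lemma prob_bind_pmf_le:
  assumes "\<And>x. x \<in> set_pmf M \<Longrightarrow> x \<notin> C \<Longrightarrow> measure_pmf.prob (f x) B \<le> measure_pmf.prob (f' x) B' + d"
    and "0 \<le> d"
  shows "measure_pmf.prob (bind_pmf M f) B
           \<le> measure_pmf.prob M C + (measure_pmf.prob (bind_pmf M f') B' + d)"
proof -
  have int: "integrable (measure_pmf M) (\<lambda>x. measure_pmf.prob (g x) X)" for g :: "'a \<Rightarrow> 'c pmf" and X
    by (intro measure_pmf.integrable_const_bound[where B = 1]) auto
  have int': "integrable (measure_pmf M) (\<lambda>x. measure_pmf.prob (g x) X)" for g :: "'a \<Rightarrow> 'd pmf" and X
    by (intro measure_pmf.integrable_const_bound[where B = 1]) auto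
  have intC: "integrable (measure_pmf M) (indicator C :: 'a \<Rightarrow> real)"
    by (simp add: measure_pmf.emeasure_eq_measure)
  have "measure_pmf.expectation M (\<lambda>x. measure_pmf.prob (f x) B)
      \<le> measure_pmf.expectation M (\<lambda>x. indicator C x + (measure_pmf.prob (f' x) B' + d))"
    using assms by (intro integral_mono_AE Bochner_Integration.integrable_add int int' intC)
      (auto simp: AE_measure_pmf_iff indicator_def intro!: add_increasing2[OF _ measure_pmf.prob_le_1])
  thus ?thesis
    by (simp add: prob_bind_pmf int' intC)
qed

section \<open>Gradients and DR-submodularity on the orthant\<close>

definition has_grad :: "(real ^ 'd \<Rightarrow> real) \<Rightarrow> (real ^ 'd \<Rightarrow> real ^ 'd) \<Rightarrow> bool" where
  "has_grad f G \<longleftrightarrow> (\<forall>x\<ge>0. (f has_derivative (\<lambda>z. G x \<bullet> z)) (at x within {0..}))"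

lemma has_gradD: "has_grad f G \<Longrightarrow> 0 \<le> x \<Longrightarrow> (f has_derivative (\<lambda>z. G x \<bullet> z)) (at x within {0..})"
  by (auto simp: has_grad_def)

lemma orthant_add: "(0 :: real ^ 'd) \<le> x \<Longrightarrow> 0 \<le> u \<Longrightarrow> 0 \<le> t \<Longrightarrow> 0 \<le> x + t *\<^sub>R u"
  by (auto simp: less_eq_vec_def)

lemma orthant_segment:
  fixes x y :: "real ^ 'd"
  assumes "0 \<le> x" "0 \<le> y" "t \<in> {0..1}"
  shows "0 \<le> x + t *\<^sub>R (y - x)"
proof -
  have "x + t *\<^sub>R (y - x) = (1 - t) *\<^sub>R x + t *\<^sub>R y" by (simp add: algebra_simps)
  thus ?thesis using assms by (auto simp: less_eq_vec_def)
qed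

lemma inner_nonneg_vec: "(0 :: real ^ 'd) \<le> x \<Longrightarrow> 0 \<le> y \<Longrightarrow> 0 \<le> x \<bullet> y"
  by (auto simp: inner_vec_def less_eq_vec_def intro!: sum_nonneg)

lemma has_derivative_line:
  fixes f :: "real ^ 'd \<Rightarrow> real"
  assumes "(f has_derivative (\<lambda>z. G \<bullet> z)) (at (x + t *\<^sub>R u) within {0..})"
    and "\<And>r. r \<in> S \<Longrightarrow> 0 \<le> x + r *\<^sub>R u"
  shows "((\<lambda>r. f (x + r *\<^sub>R u)) has_derivative (\<lambda>r. r * (G \<bullet> u))) (at t within S)"
proof -
  have 1: "((\<lambda>r. x + r *\<^sub>R u) has_derivative (\<lambda>r. r *\<^sub>R u)) (at t within S)"
    by (auto intro!: derivative_eq_intros)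
  have "(f has_derivative (\<lambda>z. G \<bullet> z)) (at (x + t *\<^sub>R u) within (\<lambda>r. x + r *\<^sub>R u) ` S)"
    by (rule has_derivative_subset[OF assms(1)]) (use assms(2) in auto)
  from has_derivative_in_compose[OF 1 this] show ?thesis by simp
qed

text \<open>Nonnegative directions do not leave the orthant, so these one-sided limits are available
  at boundary points too. Uniqueness, sign and monotonicity of gradients are all read off from them
  along the axes.\<close>

lemma directional_derivative:
  fixes f :: "real ^ 'd \<Rightarrow> real"
  assumes "(f has_derivative (\<lambda>z. G \<bullet> z)) (at x within {0..})" and "0 \<le> x" "0 \<le> u"
  shows "((\<lambda>r. (f (x + r *\<^sub>R u) - f x) / r) \<longlongrightarrow> G \<bullet> u) (at_right 0)"
proof -
  have "((\<lambda>r. f (x + r *\<^sub>R u)) has_derivative (\<lambda>r. r * (G \<bullet> u))) (at 0 within {0<..})"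
    by (rule has_derivative_line) (use assms in \<open>auto intro!: orthant_add\<close>)
  hence "((\<lambda>r. f (x + r *\<^sub>R u)) has_real_derivative G \<bullet> u) (at 0 within {0<..})"
    by (rule has_derivative_imp_has_field_derivative) simp
  thus ?thesis by (simp add: has_field_derivative_iff)
qed

lemma axis_nonneg: "0 \<le> (axis i 1 :: real ^ 'd)"
  by (auto simp: less_eq_vec_def axis_def)

lemma gradient_unique:
  fixes f :: "real ^ 'd \<Rightarrow> real"
  assumes "(f has_derivative (\<lambda>z. G \<bullet> z)) (at x within {0..})"
    and "(f has_derivative (\<lambda>z. G' \<bullet> z)) (at x within {0..})" and "0 \<le> x"
  shows "G = G'"
proof -
  have "G \<bullet> axis i 1 = G' \<bullet> axis i 1" for i
    using directional_derivative[OF assms(1,3) axis_nonneg] directional_derivative[OF assms(2,3) axis_nonneg]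
    by (rule tendsto_unique[rotated]) simp
  thus ?thesis by (simp add: inner_axis vec_eq_iff)
qed

lemma grad_eq: "has_grad f G \<Longrightarrow> 0 \<le> x \<Longrightarrow> grad f x = G x"
  unfolding grad_def by (rule the_equality) (auto intro: gradient_unique has_gradD)

lemma has_grad_grad:
  fixes f :: "real ^ 'd \<Rightarrow> real"
  assumes "f differentiable_on {0..}"
  shows "has_grad f (grad f)"
  unfolding has_grad_def
proof safe
  fix x :: "real ^ 'd" assume x: "0 \<le> x"
  then obtain D where D: "(f has_derivative D) (at x within {0..})"
    using assms unfolding differentiable_on_def differentiable_def by auto
  interpret bounded_linear D by (rule has_derivative_bounded_linear[OF D])
  have "D z = (\<Sum>b\<in>Basis. D b *\<^sub>R b) \<bullet> z" for z
  proof -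
    have "D z = D (\<Sum>b\<in>Basis. (z \<bullet> b) *\<^sub>R b)" by (simp add: euclidean_representation)
    also have "\<dots> = (\<Sum>b\<in>Basis. (z \<bullet> b) * D b)" by (simp add: sum scaleR)
    also have "\<dots> = (\<Sum>b\<in>Basis. D b *\<^sub>R b) \<bullet> z"
      by (simp add: inner_sum_left inner_commute[of z] mult.commute)
    finally show ?thesis .
  qed
  hence "D = (\<lambda>z. (\<Sum>b\<in>Basis. D b *\<^sub>R b) \<bullet> z)" by blast
  with D have D': "(f has_derivative (\<lambda>z. (\<Sum>b\<in>Basis. D b *\<^sub>R b) \<bullet> z)) (at x within {0..})" by simp
  show "(f has_derivative (\<lambda>z. grad f x \<bullet> z)) (at x within {0..})"
    unfolding grad_def by (rule theI[where a = "\<Sum>b\<in>Basis. D b *\<^sub>R b"])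
      (use D' x gradient_unique in blast)+
qed

lemma smooth_has_grad: "smooth b f \<Longrightarrow> has_grad f (grad f)"
  by (auto simp: smooth_def intro: has_grad_grad)

section \<open>Closure properties of smooth functions\<close>

lemma smoothI:
  assumes "has_grad f G" and "b-lipschitz_on {0..} G"
  shows "smooth b f"
  unfolding smooth_def
proof
  show "f differentiable_on {0..}"
    using assms(1) unfolding differentiable_on_def differentiable_def has_grad_def by auto
  show "b-lipschitz_on {0..} (grad f)"
    by (rule lipschitz_on_transform[OF assms(2)]) (use grad_eq[OF assms(1)] in auto)
qed

lemma smooth_const: "smooth 0 (\<lambda>_. a)"
  by (rule smoothI[where G = "\<lambda>_. 0"]) (auto simp: has_grad_def intro: lipschitz_on_constant)

lemma smooth_add:
  assumes "smooth a f" "smooth b g"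
  shows "smooth (a + b) (\<lambda>x. f x + g x)"
proof (rule smoothI)
  show "has_grad (\<lambda>x. f x + g x) (\<lambda>x. grad f x + grad g x)"
    using has_derivative_add[OF assms[THEN smooth_has_grad, THEN has_gradD]]
    unfolding has_grad_def inner_add_left by blast
  show "(a + b)-lipschitz_on {0..} (\<lambda>x. grad f x + grad g x)"
    using assms by (auto simp: smooth_def intro: lipschitz_on_add)
qed

lemma smooth_cmult:
  assumes "smooth a f" "0 \<le> r"
  shows "smooth (r * a) (\<lambda>x. r * f x)"
proof (rule smoothI)
  show "has_grad (\<lambda>x. r * f x) (\<lambda>x. r *\<^sub>R grad f x)"
    unfolding has_grad_def inner_scaleR_left
    by (intro allI impI has_derivative_mult_right has_gradD[OF smooth_has_grad[OF assms(1)]])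
  show "(r * a)-lipschitz_on {0..} (\<lambda>x. r *\<^sub>R grad f x)"
    using assms by (auto simp: smooth_def intro: lipschitz_on_cmult_nonneg)
qed

lemma smooth_sum_list:
  assumes "\<And>i. i \<in> set xs \<Longrightarrow> smooth (b i) (f i)"
  shows "smooth (\<Sum>i\<leftarrow>xs. b i) (\<lambda>x. \<Sum>i\<leftarrow>xs. f i x)"
  using assms by (induction xs) (auto intro: smooth_const smooth_add)

section \<open>Gradients of monotone, Lipschitz and DR-submodular functions\<close>

lemma grad_nonneg:
  assumes "has_grad f G" "mono_on {0..} f" "0 \<le> x"
  shows "0 \<le> G x"
proof -
  have "0 \<le> G x \<bullet> axis i 1" for i
  proof (rule tendsto_lowerbound[OF directional_derivative[OF has_gradD[OF assms(1,3)] assms(3) axis_nonneg]])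
    show "\<forall>\<^sub>F r in at_right 0. 0 \<le> (f (x + r *\<^sub>R axis i 1) - f x) / r"
    proof (rule eventually_at_right_less[THEN eventually_mono])
      fix r :: real assume r: "0 < r"
      have "f x \<le> f (x + r *\<^sub>R axis i 1)"
      proof (rule mono_onD[OF assms(2)])
        show "x \<le> x + r *\<^sub>R axis i 1"
          using orthant_add[OF order.refl axis_nonneg, of r] r by (simp add: less_eq_vec_def)
      qed (use assms(3) r in \<open>auto intro!: orthant_add axis_nonneg\<close>)
      thus "0 \<le> (f (x + r *\<^sub>R axis i 1) - f x) / r" using r by simp
    qed
  qed simp
  thus ?thesis by (simp add: less_eq_vec_def inner_axis)
qed

text \<open>At a boundary point difference quotients exist only along directions that stay in the
  orthant. Monotonicity makes \<open>G x\<close> itself such a direction, and along it the quotient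
  tends to the squared norm of \<open>G x\<close>.\<close>

lemma norm_grad_le:
  assumes "has_grad f G" "mono_on {0..} f" "L-lipschitz_on {0..} f" "0 \<le> x"
  shows "norm (G x) \<le> L"
proof -
  note G = grad_nonneg[OF assms(1,2,4)]
  have "G x \<bullet> G x \<le> L * norm (G x)"
  proof (rule tendsto_upperbound[OF directional_derivative[OF has_gradD[OF assms(1,4)] assms(4) G]])
    show "\<forall>\<^sub>F r in at_right 0. (f (x + r *\<^sub>R G x) - f x) / r \<le> L * norm (G x)"
    proof (rule eventually_at_right_less[THEN eventually_mono])
      fix r :: real assume r: "0 < r"
      have "f (x + r *\<^sub>R G x) - f x \<le> L * norm (r *\<^sub>R G x)"
        using lipschitz_on_normD[OF assms(3), of "x + r *\<^sub>R G x" x] assms(4) G r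
        by (auto simp: orthant_add)
      thus "(f (x + r *\<^sub>R G x) - f x) / r \<le> L * norm (G x)" using r by (simp add: field_simps)
    qed
  qed simp
  hence "norm (G x) * norm (G x) \<le> L * norm (G x)"
    by (simp add: dot_square_norm power2_eq_square)
  thus ?thesis using lipschitz_on_nonneg[OF assms(3)] by (cases "G x = 0") auto
qed

lemma dr_submodular_grad_antimono:
  assumes "has_grad f G" "dr_submodular f" "0 \<le> x" "x \<le> y"
  shows "G y \<le> G x"
proof -
  have y: "0 \<le> y" using assms(3,4) by simp
  have "G y \<bullet> axis i 1 \<le> G x \<bullet> axis i 1" for i
  proof (rule tendsto_le[OF _ directional_derivative directional_derivative])
    show "\<forall>\<^sub>F r in at_right 0. (f (y + r *\<^sub>R axis i 1) - f y) / r \<le> (f (x + r *\<^sub>R axis i 1) - f x) / r"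
      by (rule eventually_at_right_less[THEN eventually_mono])
         (use assms(2-4) in \<open>auto simp: dr_submodular_def intro!: divide_right_mono\<close>)
  qed (use assms(1,3) y in \<open>auto intro: has_gradD axis_nonneg\<close>)
  thus ?thesis by (simp add: less_eq_vec_def inner_axis)
qed

lemma has_grad_mvt:
  assumes "has_grad f G" "0 \<le> x" "0 \<le> y"
  obtains r where "r \<in> {0..1}" "f y - f x = G (x + r *\<^sub>R (y - x)) \<bullet> (y - x)"
proof -
  have "\<exists>r\<in>{0<..<1}. f (x + 1 *\<^sub>R (y - x)) - f (x + 0 *\<^sub>R (y - x))
          = (1 - 0) * (G (x + r *\<^sub>R (y - x)) \<bullet> (y - x))"
    by (rule mvt_simple)
       (use assms in \<open>auto intro!: has_derivative_line has_gradD orthant_segment\<close>)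
  then obtain r where "r \<in> {0<..<1}" "f y - f x = G (x + r *\<^sub>R (y - x)) \<bullet> (y - x)" by auto
  thus ?thesis by (intro that[of r]) auto
qed

text \<open>Concavity along nonnegative directions: the mean value point lies between
  \<open>x\<close> and \<open>y\<close>, hence the gradient there lies between \<open>G y\<close>
  and \<open>G x\<close>.\<close>

lemma dr_submodular_le_grad:
  assumes "has_grad f G" "dr_submodular f" "0 \<le> x" "x \<le> y"
  shows "f y - f x \<le> G x \<bullet> (y - x)" and "G y \<bullet> (y - x) \<le> f y - f x"
proof -
  have y: "0 \<le> y" using assms(3,4) by simp
  have d: "0 \<le> y - x" using assms(4) by (simp add: less_eq_vec_def)
  obtain r where r: "r \<in> {0..1}" "f y - f x = G (x + r *\<^sub>R (y - x)) \<bullet> (y - x)"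
    using has_grad_mvt[OF assms(1,3) y] .
  let ?z = "x + r *\<^sub>R (y - x)"
  have z: "x \<le> ?z" "?z \<le> y" "0 \<le> ?z"
  proof -
    show "0 \<le> ?z" by (rule orthant_segment[OF assms(3) y r(1)])
    show "x \<le> ?z" using d r(1) by (auto simp: less_eq_vec_def)
    have "r * (y $ i - x $ i) \<le> 1 * (y $ i - x $ i)" for i
      using d r(1) by (intro mult_right_mono) (auto simp: less_eq_vec_def)
    thus "?z \<le> y" by (auto simp: less_eq_vec_def algebra_simps)
  qed
  have "0 \<le> (G x - G ?z) \<bullet> (y - x)" "0 \<le> (G ?z - G y) \<bullet> (y - x)"
    using dr_submodular_grad_antimono[OF assms(1,2,3) z(1)]
          dr_submodular_grad_antimono[OF assms(1,2) z(3,2)] d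
    by (auto intro!: inner_nonneg_vec simp: less_eq_vec_def)
  thus "f y - f x \<le> G x \<bullet> (y - x)" "G y \<bullet> (y - x) \<le> f y - f x"
    by (simp_all add: r(2) inner_diff_left)
qed

definition vec_min :: "real ^ 'd \<Rightarrow> real ^ 'd \<Rightarrow> real ^ 'd" where
  "vec_min x y = (\<chi> i. min (x $ i) (y $ i))"

lemma vec_min: "vec_min x y \<le> x" "vec_min x y \<le> y" "0 \<le> x \<Longrightarrow> 0 \<le> y \<Longrightarrow> 0 \<le> vec_min x y"
  by (auto simp: vec_min_def less_eq_vec_def)

text \<open>Concavity along \<open>y \<or> x - x \<ge> 0\<close> and along \<open>x \<and> y - x \<le> 0\<close>, combined.\<close>

lemma dr_submodular_grad_ge:
  fixes f :: "real ^ 'd \<Rightarrow> real"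
  assumes "has_grad f G" "dr_submodular f" "mono_on {0..} f" "\<And>x. 0 \<le> x \<Longrightarrow> 0 \<le> f x"
    and x: "0 \<le> x" and y: "0 \<le> y"
  shows "f y - 2 * f x \<le> G x \<bullet> (y - x)"
proof -
  define m where "m = vec_min x y"
  \<comment> \<open>The componentwise maximum, in a form where \<open>M - x\<close> splits into
    \<open>y - x\<close> and \<open>x - m\<close>.\<close>
  define M where "M = x + y - m"
  have m: "0 \<le> m" "m \<le> x" "m \<le> y" using vec_min x y by (auto simp: m_def)
  have M: "x \<le> M" "y \<le> M" using m by (auto simp: M_def less_eq_vec_def algebra_simps)
  have "f y \<le> f M" using M y by (intro mono_onD[OF assms(3)]) auto
  also have "f M \<le> f x + G x \<bullet> (M - x)"
    using dr_submodular_le_grad(1)[OF assms(1,2) x M(1)] by simp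
  also have "G x \<bullet> (M - x) = G x \<bullet> (y - x) + G x \<bullet> (x - m)"
    by (simp add: M_def inner_diff_right inner_add_right)
  also have "G x \<bullet> (x - m) \<le> f x - f m"
    by (rule dr_submodular_le_grad(2)[OF assms(1,2) m(1,2)])
  also have "f x - f m \<le> f x" using assms(4)[OF m(1)] by simp
  finally show ?thesis by simp
qed

text \<open>The descent inequality. \<open>\<psi>\<close> is \<open>f\<close> along the segment,
  minus its linear part, plus the quadratic that outweighs the variation of the gradient; its
  derivative is nonnegative by Cauchy-Schwarz, so a single mean value step replaces an
  integration.\<close>

lemma smooth_lower_bound:
  fixes f :: "real ^ 'd \<Rightarrow> real"
  assumes "smooth b f" and x: "0 \<le> x" and y: "0 \<le> y"
  shows "f x + grad f x \<bullet> (y - x) - b / 2 * (norm (y - x))\<^sup>2 \<le> f y"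
proof -
  define \<psi> where "\<psi> r = f (x + r *\<^sub>R (y - x)) - r * (grad f x \<bullet> (y - x)) + b / 2 * r\<^sup>2 * (norm (y - x))\<^sup>2" for r
  define \<psi>' where "\<psi>' r = (grad f (x + r *\<^sub>R (y - x)) - grad f x) \<bullet> (y - x) + b * r * (norm (y - x))\<^sup>2" for r
  have "\<exists>r\<in>{0<..<1}. \<psi> 1 - \<psi> 0 = (1 - 0) * \<psi>' r"
  proof (rule mvt_simple)
    fix r :: real assume r: "0 \<le> r" "r \<le> 1"
    have "((\<lambda>r. f (x + r *\<^sub>R (y - x))) has_derivative (\<lambda>s. s * (grad f (x + r *\<^sub>R (y - x)) \<bullet> (y - x))))
            (at r within {0..1})"
      using r x y
      by (intro has_derivative_line has_gradD[OF smooth_has_grad[OF assms(1)]] orthant_segment) auto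
    thus "(\<psi> has_derivative (\<lambda>s. s * \<psi>' r)) (at r within {0..1})"
      unfolding \<psi>_def \<psi>'_def
      by (auto intro!: derivative_eq_intros simp: algebra_simps inner_diff_left)
  qed simp
  then obtain r where r: "0 < r" "r < 1" "\<psi> 1 - \<psi> 0 = \<psi>' r" by auto
  have "\<bar>(grad f (x + r *\<^sub>R (y - x)) - grad f x) \<bullet> (y - x)\<bar>
      \<le> norm (grad f (x + r *\<^sub>R (y - x)) - grad f x) * norm (y - x)"
    by (rule Cauchy_Schwarz_ineq2)
  also have "norm (grad f (x + r *\<^sub>R (y - x)) - grad f x) \<le> b * norm (x + r *\<^sub>R (y - x) - x)"
    using assms(1) x orthant_segment[OF x y, of r] r
    by (intro lipschitz_on_normD) (auto simp: smooth_def)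
  also have "b * norm (x + r *\<^sub>R (y - x) - x) * norm (y - x) = b * r * (norm (y - x))\<^sup>2"
    using r(1) by (simp add: power2_eq_square)
  finally have "0 \<le> \<psi>' r" by (auto simp: \<psi>'_def mult_right_mono)
  with r(3) show ?thesis by (simp add: \<psi>_def)
qed

text \<open>
  For a difference of two monotone functions the Lipschitz constants combine with the factor
  \<open>sqrt 2\<close> instead of \<open>2\<close>: compare both points with their componentwise minimum; the two
  displacements have disjoint supports.
\<close>

lemma mono_lipschitz_diff:
  fixes f g :: "real ^ 'd \<Rightarrow> real"
  assumes "mono_on {0..} f" "mono_on {0..} g" "L-lipschitz_on {0..} f" "L-lipschitz_on {0..} g"
    and x: "0 \<le> x" and y: "0 \<le> y"
  shows "(f x - g x) - (f y - g y) \<le> sqrt 2 * L * norm (x - y)"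
proof -
  define m where "m = vec_min x y"
  have m: "0 \<le> m" "m \<le> x" "m \<le> y" using vec_min x y by (auto simp: m_def)
  have L: "0 \<le> L" using assms(3) by (rule lipschitz_on_nonneg)
  have "f x - f m \<le> L * norm (x - m)" "g y - g m \<le> L * norm (y - m)"
    using lipschitz_on_normD[OF assms(3), of x m] lipschitz_on_normD[OF assms(4), of y m] x y m
    by auto
  \<comment> \<open>By monotonicity the other two differences have the favourable sign, so only the
    drop of \<open>f\<close> from \<open>x\<close> to \<open>m\<close> and that of \<open>g\<close>
    from \<open>y\<close> to \<open>m\<close> cost anything.\<close>
  moreover have "f m \<le> f y" "g m \<le> g x"
    using assms(1,2) x y m by (auto intro: mono_onD)
  ultimately have "(f x - g x) - (f y - g y) \<le> L * (norm (x - m) + norm (y - m))"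
    by (simp add: algebra_simps)
  also have "L * (norm (x - m) + norm (y - m)) \<le> L * sqrt (2 * ((norm (x - m))\<^sup>2 + (norm (y - m))\<^sup>2))"
    using sum_squares_bound[of "norm (x - m)" "norm (y - m)"]
    by (intro mult_left_mono L real_le_rsqrt) (simp add: power2_eq_square algebra_simps)
  also have "(norm (x - m))\<^sup>2 + (norm (y - m))\<^sup>2 = (norm (x - y))\<^sup>2"
  proof -
    have "(x - m) \<bullet> (y - m) = 0"
      unfolding inner_vec_def by (intro sum.neutral) (auto simp: m_def vec_min_def min_def)
    moreover have "(norm (x - y))\<^sup>2 = (norm ((x - m) - (y - m)))\<^sup>2" by simp
    ultimately show ?thesis
      by (simp only: power2_norm_eq_inner inner_diff_left inner_diff_right inner_commute)
  qed
  finally show ?thesis by (simp add: real_sqrt_mult algebra_simps)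
qed

section \<open>Reverse reachable sets and the estimator\<close>

definition reverse_reach :: "('v \<Rightarrow> 'v set) \<Rightarrow> 'v \<Rightarrow> 'v set" where
  "reverse_reach T v = {w. (w, v) \<in> {(w', u). w' \<in> T u}\<^sup>*}"

text \<open>For fixed triggering sets the cascade is reachability in the live-edge graph. Reading
  the edges backwards from \<open>v\<close> turns activation into hitting a set that does not depend
  on \<open>S\<close>.\<close>

lemma final_active_iff: "v \<in> final_active T S \<longleftrightarrow> S \<inter> reverse_reach T v \<noteq> {}"
proof
  have "\<exists>w\<in>S. (w, v) \<in> {(w', u). w' \<in> T u}\<^sup>*" if "v \<in> active_at T S t" for t
    using that
  proof (induction t arbitrary: v)
    case (Suc t)
    show ?case
    proof (cases "v \<in> active_at T S t")
      case False
      then obtain u where u: "u \<in> T v" "u \<in> active_at T S t" using Suc.prems by auto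
      with Suc.IH obtain w where "w \<in> S" "(w, u) \<in> {(w', u). w' \<in> T u}\<^sup>*" by blast
      with u(1) show ?thesis by (blast intro: rtrancl_into_rtrancl)
    qed (use Suc.IH in blast)
  qed auto
  thus "v \<in> final_active T S \<Longrightarrow> S \<inter> reverse_reach T v \<noteq> {}"
    by (auto simp: final_active_def reverse_reach_def)
next
  assume "S \<inter> reverse_reach T v \<noteq> {}"
  then obtain w where w: "w \<in> S" "(w, v) \<in> {(w', u). w' \<in> T u}\<^sup>*"
    by (auto simp: reverse_reach_def)
  from w(2) have "\<exists>t. v \<in> active_at T S t"
  proof (induction rule: rtrancl_induct)
    case base
    show ?case using w(1) by (intro exI[of _ 0]) simp
  next
    case (step u v)
    then obtain t where "u \<in> active_at T S t" by blast
    with step.hyps(2) show ?case by (intro exI[of _ "Suc t"]) auto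
  qed
  thus "v \<in> final_active T S" by (auto simp: final_active_def)
qed

text \<open>For \<open>x\<close> in the orthant this is the probability that a random seed set,
  containing each \<open>v\<close> independently with probability \<open>h v x\<close>, meets
  \<open>R\<close>.\<close>

definition hit :: "('v \<Rightarrow> 'b \<Rightarrow> real) \<Rightarrow> 'v set \<Rightarrow> 'b \<Rightarrow> real" where
  "hit h R x = 1 - (\<Prod>v\<in>R. 1 - h v x)"

lemma sum_random_set_hit:
  fixes p :: "'v::finite \<Rightarrow> real"
  shows "(\<Sum>S\<in>UNIV. of_bool (S \<inter> R \<noteq> {}) * ((\<Prod>u\<in>S. p u) * (\<Prod>v\<in>-S. 1 - p v)))
           = 1 - (\<Prod>v\<in>R. 1 - p v)"
proof -
  let ?w = "\<lambda>S. (\<Prod>u\<in>S. p u) * (\<Prod>v\<in>-S. 1 - p v)"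
  have all: "(\<Sum>S\<in>UNIV. ?w S) = 1"
    using prod_add[of UNIV p "\<lambda>v. 1 - p v"] by (simp add: Compl_eq_Diff_UNIV)
  \<comment> \<open>Damping the factors in \<open>R\<close> to 0 encodes the event that
    \<open>S\<close> misses \<open>R\<close> in the product itself, so \<open>prod_add\<close>
    applies; a node outside \<open>R\<close> then contributes
    \<open>p v + (1 - p v) = 1\<close>.\<close>
  have "(\<Prod>u\<in>S. p u * of_bool (u \<notin> R)) = of_bool (S \<inter> R = {}) * (\<Prod>u\<in>S. p u)" for S
  proof (cases "S \<inter> R = {}")
    case False
    then obtain u where "u \<in> S" "u \<in> R" by blast
    with False show ?thesis by (auto intro!: prod_zero)
  qed (auto intro!: prod.cong)
  hence "(\<Sum>S\<in>UNIV. of_bool (S \<inter> R = {}) * ?w S) = (\<Prod>v\<in>UNIV. p v * of_bool (v \<notin> R) + (1 - p v))"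
    by (simp add: prod_add Compl_eq_Diff_UNIV mult.assoc)
  also have "\<dots> = (\<Prod>v\<in>R. 1 - p v)"
    by (rule prod.mono_neutral_cong_right) auto
  finally have "(\<Sum>S\<in>UNIV. of_bool (S \<inter> R = {}) * ?w S) = (\<Prod>v\<in>R. 1 - p v)" .
  moreover have "of_bool (S \<inter> R \<noteq> {}) * ?w S = ?w S - of_bool (S \<inter> R = {}) * ?w S" for S
    by simp
  ultimately show ?thesis using all by (simp only: sum_subtractf)
qed

lemma rr_set_alt:
  "rr_set Tr = pmf_of_set UNIV \<bind> (\<lambda>v. map_pmf (\<lambda>T. reverse_reach T v) (triggering_sets Tr))"
  by (simp add: rr_set_def map_pmf_def reverse_reach_def)

lemma rr_set_nonempty: "R \<in> set_pmf (rr_set Tr) \<Longrightarrow> R \<noteq> {}"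
  by (auto simp: rr_set_alt reverse_reach_def)

text \<open>Unbiasedness of the estimator. Activated nodes are counted root by root and the seed set
  is summed out for fixed triggering sets; the uniform root turns the sum over \<open>v\<close> into
  \<open>CARD('v)\<close> times a mean.\<close>

lemma cim_g_eq_expectation_hit:
  fixes Tr :: "'v::finite \<Rightarrow> 'v set pmf"
  shows "cim_g Tr h x = real CARD('v) * measure_pmf.expectation (rr_set Tr) (\<lambda>R. hit h R x)"
proof -
  let ?T = "measure_pmf (triggering_sets Tr)"
  let ?w = "\<lambda>S. (\<Prod>u\<in>S. h u x) * (\<Prod>v\<in>-S. 1 - h v x)"
  have int: "integrable ?T f" for f :: "('v \<Rightarrow> 'v set) \<Rightarrow> real"
    by (rule integrable_measure_pmf_finite) simp
  have card: "real (card (final_active T S)) = (\<Sum>v\<in>UNIV. of_bool (S \<inter> reverse_reach T v \<noteq> {}))"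
    for T :: "'v \<Rightarrow> 'v set" and S
    by (simp add: final_active_iff[symmetric] sum.If_cases of_bool_def)
  have "cim_g Tr h x = (\<Sum>S\<in>UNIV. (\<integral>T. real (card (final_active T S)) * ?w S \<partial>?T))"
    by (simp add: cim_g_def spread_def int mult.assoc)
  also have "\<dots> = (\<integral>T. (\<Sum>S\<in>UNIV. \<Sum>v\<in>UNIV. of_bool (S \<inter> reverse_reach T v \<noteq> {}) * ?w S) \<partial>?T)"
    by (simp add: int card sum_distrib_right flip: Bochner_Integration.integral_sum)
  also have "\<dots> = (\<integral>T. (\<Sum>v\<in>UNIV. hit h (reverse_reach T v) x) \<partial>?T)"
    by (subst sum.swap) (simp add: sum_random_set_hit hit_def)
  also have "\<dots> = (\<Sum>v\<in>UNIV. (\<integral>T. hit h (reverse_reach T v) x \<partial>?T))"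
    by (simp add: int)
  also have "\<dots> = real CARD('v) * measure_pmf.expectation (rr_set Tr) (\<lambda>R. hit h R x)"
    unfolding rr_set_alt
    by (subst pmf_expectation_bind_pmf_of_set) (auto simp: sum_distrib_left[symmetric] divide_inverse sum_divide_distrib[symmetric])
  finally show ?thesis .
qed

lemma ghat_eq_sum_hit:
  "ghat h Rs x = real CARD('v) / real (length Rs) * (\<Sum>R\<leftarrow>Rs. hit h R x)"
  for h :: "'v::finite \<Rightarrow> real ^ 'd \<Rightarrow> real"
  by (simp add: ghat_def hit_def)

section \<open>Regularity of \<open>hit\<close>, \<open>ghat\<close> and \<open>cim_g\<close> on the
  orthant\<close>

locale activation =
  fixes h :: "'v::finite \<Rightarrow> real ^ 'd \<Rightarrow> real" and Lh \<beta>h :: real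
  assumes h_range: "0 \<le> x \<Longrightarrow> h v x \<in> {0..1}"
    and h_mono: "mono_on {0..} (h v)"
    and h_dr: "dr_submodular (h v)"
    and h_lip: "Lh-lipschitz_on {0..} (h v)"
    and h_smooth: "smooth \<beta>h (h v)"
begin

lemma Lh_nonneg: "0 \<le> Lh" and \<beta>h_nonneg: "0 \<le> \<beta>h"
  using lipschitz_on_nonneg[OF h_lip] h_smooth lipschitz_on_nonneg[of \<beta>h "{0..}"]
  by (auto simp: smooth_def)

lemma prod_range: "0 \<le> x \<Longrightarrow> (\<Prod>v\<in>R. 1 - h v x) \<in> {0..1}"
  using h_range by (auto intro!: prod_nonneg prod_le_1)

lemma prod_lipschitz:
  assumes "0 \<le> x" "0 \<le> y"
  shows "\<bar>(\<Prod>v\<in>R. 1 - h v x) - (\<Prod>v\<in>R. 1 - h v y)\<bar> \<le> real (card R) * (Lh * norm (x - y))"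
proof -
  have "\<bar>(\<Prod>v\<in>R. 1 - h v x) - (\<Prod>v\<in>R. 1 - h v y)\<bar> \<le> (\<Sum>v\<in>R. \<bar>(1 - h v x) - (1 - h v y)\<bar>)"
    using norm_prod_diff[of R "\<lambda>v. 1 - h v x" "\<lambda>v. 1 - h v y"] h_range[OF assms(1)] h_range[OF assms(2)]
    by fastforce
  also have "\<dots> \<le> (\<Sum>v\<in>R. Lh * norm (x - y))"
    using lipschitz_on_normD[OF h_lip, of x y] assms by (intro sum_mono) (auto simp: abs_minus_commute)
  finally show ?thesis by simp
qed

lemma hit_range: "0 \<le> x \<Longrightarrow> hit h R x \<in> {0..1}"
  using prod_range[of x R] by (simp add: hit_def)

lemma hit_mono: "mono_on {0..} (hit h R)"
proof (rule mono_onI)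
  fix x y :: "real ^ 'd" assume "x \<in> {0..}" "y \<in> {0..}" "x \<le> y"
  moreover from this have "h v x \<le> h v y" "h v y \<le> 1" for v
    using mono_onD[OF h_mono] h_range[of y v] by auto
  ultimately show "hit h R x \<le> hit h R y"
    by (auto simp: hit_def intro!: prod_mono)
qed

lemma hit_lipschitz: "(real CARD('v) * Lh)-lipschitz_on {0..} (hit h R)"
proof (rule lipschitz_onI)
  fix x y :: "real ^ 'd" assume "x \<in> {0..}" "y \<in> {0..}"
  hence "dist (hit h R x) (hit h R y) \<le> real (card R) * (Lh * dist x y)"
    using prod_lipschitz[of x y R] by (simp add: hit_def dist_norm abs_minus_commute)
  also have "\<dots> \<le> real CARD('v) * (Lh * dist x y)"
    using Lh_nonneg by (intro mult_right_mono) (auto intro: card_mono)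
  finally show "dist (hit h R x) (hit h R y) \<le> real CARD('v) * Lh * dist x y" by (simp add: mult.assoc)
qed (use Lh_nonneg in auto)

text \<open>The decrement of a product \<open>A * B\<close> is (decrement of \<open>A\<close>) times
  \<open>B\<close> plus (shifted \<open>A\<close>) times (decrement of \<open>B\<close>). For
  nonnegative antitone factors with antitone decrements every quantity here is nonnegative and
  antitone, so the property passes to the product and induction on \<open>R\<close> applies.\<close>

lemma hit_dr: "dr_submodular (hit h R)"
proof -
  have "(\<Prod>v\<in>R. 1 - h v y) - (\<Prod>v\<in>R. 1 - h v (y + d *\<^sub>R axis i 1))
      \<le> (\<Prod>v\<in>R. 1 - h v x) - (\<Prod>v\<in>R. 1 - h v (x + d *\<^sub>R axis i 1))"
    if x: "0 \<le> x" "x \<le> y" and d: "0 < d" for x y :: "real ^ 'd" and d i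
    using finite[of R]
  proof (induction R rule: finite_induct)
    case (insert v R)
    have y: "0 \<le> y" using x by simp
    let ?e = "d *\<^sub>R axis i 1 :: real ^ 'd"
    have e: "0 \<le> ?e" using axis_nonneg[of i] d by (simp add: less_eq_vec_def)
    have le: "x \<le> x + ?e" "y \<le> y + ?e" "x + ?e \<le> y + ?e" "0 \<le> x + ?e" "0 \<le> y + ?e"
      using e x y by (auto simp: less_eq_vec_def intro: add_nonneg_nonneg)
    let ?A = "\<lambda>z. 1 - h v z" and ?B = "\<lambda>z. \<Prod>v\<in>R. 1 - h v z"
    have B_anti: "?B w \<le> ?B z" if "0 \<le> z" "z \<le> w" for z w
      using mono_onD[OF hit_mono[of R], of z w] that by (simp add: hit_def order.trans[OF that])
    have A_anti: "?A w \<le> ?A z" if "0 \<le> z" "z \<le> w" for z w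
      using mono_onD[OF h_mono[of v], of z w] that by (simp add: order.trans[OF that])
    have A_dr: "?A y - ?A (y + ?e) \<le> ?A x - ?A (x + ?e)"
      using h_dr[of v] x d unfolding dr_submodular_def by auto
    have nonneg: "0 \<le> ?A z" "0 \<le> ?B z" if "0 \<le> z" for z
      using h_range[OF that, of v] prod_range[OF that, of R] by auto
    have "?A y * ?B y - ?A (y + ?e) * ?B (y + ?e)
        = (?A y - ?A (y + ?e)) * ?B y + ?A (y + ?e) * (?B y - ?B (y + ?e))"
      by (simp add: algebra_simps)
    also have "\<dots> \<le> (?A x - ?A (x + ?e)) * ?B x + ?A (x + ?e) * (?B x - ?B (x + ?e))"
      using A_dr insert.IH B_anti[OF x] A_anti[OF le(4,3)] A_anti[OF x(1) le(1)] B_anti[OF y le(2)]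
        nonneg[OF y] nonneg[OF le(4)]
      by (intro add_mono mult_mono) auto
    also have "\<dots> = ?A x * ?B x - ?A (x + ?e) * ?B (x + ?e)"
      by (simp add: algebra_simps)
    finally show ?case using insert.hyps by simp
  qed simp
  thus ?thesis unfolding dr_submodular_def hit_def by force
qed

text \<open>By the product rule each summand of the gradient is a factor in [0, 1] with Lipschitz
  constant \<open>card R * Lh\<close> times a gradient of norm at most \<open>Lh\<close> with
  Lipschitz constant \<open>\<beta>h\<close>. Averaging the resulting constant over the sample
  produces the two moments in \<open>inner_beta\<close>.\<close>

lemma hit_smooth: "smooth (real (card R) * \<beta>h + (real (card R))\<^sup>2 * Lh\<^sup>2) (hit h R)"
proof (rule smoothI)
  define Q where "Q v x = (\<Prod>u\<in>R - {v}. 1 - h u x)" for v x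
  define G where "G x = (\<Sum>v\<in>R. Q v x *\<^sub>R grad (h v) x)" for x
  show "has_grad (hit h R) G"
    unfolding has_grad_def
  proof safe
    fix x :: "real ^ 'd" assume x: "0 \<le> x"
    have "((\<lambda>x. \<Prod>v\<in>R. 1 - h v x) has_derivative
            (\<lambda>z. \<Sum>v\<in>R. (0 - grad (h v) x \<bullet> z) * (\<Prod>u\<in>R - {v}. 1 - h u x))) (at x within {0..})"
      using has_gradD[OF smooth_has_grad[OF h_smooth] x]
      by (intro has_derivative_prod has_derivative_diff has_derivative_const)
    hence "(hit h R has_derivative
            (\<lambda>z. 0 - (\<Sum>v\<in>R. (0 - grad (h v) x \<bullet> z) * (\<Prod>u\<in>R - {v}. 1 - h u x)))) (at x within {0..})"
      unfolding hit_def [abs_def] by (intro has_derivative_diff has_derivative_const)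
    also have "(\<lambda>z. 0 - (\<Sum>v\<in>R. (0 - grad (h v) x \<bullet> z) * (\<Prod>u\<in>R - {v}. 1 - h u x))) = (\<lambda>z. G x \<bullet> z)"
      by (simp add: G_def Q_def inner_sum_left sum_negf mult.commute)
    finally show "(hit h R has_derivative (\<lambda>z. G x \<bullet> z)) (at x within {0..})" .
  qed
  show "(real (card R) * \<beta>h + (real (card R))\<^sup>2 * Lh\<^sup>2)-lipschitz_on {0..} G"
  proof (rule lipschitz_onI)
    fix x y :: "real ^ 'd" assume "x \<in> {0..}" "y \<in> {0..}"
    hence x: "0 \<le> x" and y: "0 \<le> y" by auto
    have "norm (Q v x *\<^sub>R grad (h v) x - Q v y *\<^sub>R grad (h v) y)
            \<le> (\<beta>h + real (card R) * Lh\<^sup>2) * norm (x - y)" for v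
    proof -
      have "norm (Q v x *\<^sub>R grad (h v) x - Q v y *\<^sub>R grad (h v) y)
          = norm (Q v x *\<^sub>R (grad (h v) x - grad (h v) y) + (Q v x - Q v y) *\<^sub>R grad (h v) y)"
        by (simp add: algebra_simps)
      also have "\<dots> \<le> \<bar>Q v x\<bar> * norm (grad (h v) x - grad (h v) y) + \<bar>Q v x - Q v y\<bar> * norm (grad (h v) y)"
        using norm_triangle_ineq[of "Q v x *\<^sub>R (grad (h v) x - grad (h v) y)" "(Q v x - Q v y) *\<^sub>R grad (h v) y"]
        by simp
      also have "\<dots> \<le> 1 * (\<beta>h * norm (x - y)) + (real (card R) * (Lh * norm (x - y))) * Lh"
      proof (intro add_mono mult_mono)
        show "\<bar>Q v x\<bar> \<le> 1" using prod_range[OF x, of "R - {v}"] by (simp add: Q_def)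
        show "norm (grad (h v) x - grad (h v) y) \<le> \<beta>h * norm (x - y)"
          using h_smooth x y by (intro lipschitz_on_normD) (auto simp: smooth_def)
        have "\<bar>Q v x - Q v y\<bar> \<le> real (card (R - {v})) * (Lh * norm (x - y))"
          unfolding Q_def by (rule prod_lipschitz[OF x y])
        also have "\<dots> \<le> real (card R) * (Lh * norm (x - y))"
          using Lh_nonneg by (intro mult_right_mono) (auto intro: card_mono)
        finally show "\<bar>Q v x - Q v y\<bar> \<le> real (card R) * (Lh * norm (x - y))" .
        show "norm (grad (h v) y) \<le> Lh"
          by (rule norm_grad_le[OF smooth_has_grad[OF h_smooth] h_mono h_lip y])
      qed (use Lh_nonneg in auto)
      finally show ?thesis by (simp add: power2_eq_square algebra_simps)
    qed
    hence "norm (G x - G y) \<le> (\<Sum>v\<in>R. (\<beta>h + real (card R) * Lh\<^sup>2) * norm (x - y))"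
      unfolding G_def sum_subtractf[symmetric] by (intro sum_norm_le) auto
    thus "dist (G x) (G y) \<le> (real (card R) * \<beta>h + (real (card R))\<^sup>2 * Lh\<^sup>2) * dist x y"
      by (simp add: dist_norm power2_eq_square algebra_simps)
  qed (use \<beta>h_nonneg in auto)
qed

lemma ghat_nonneg: "0 \<le> x \<Longrightarrow> 0 \<le> ghat h Rs x"
  using hit_range unfolding ghat_eq_sum_hit
  by (intro mult_nonneg_nonneg sum_list_nonneg) auto

lemma ghat_mono: "mono_on {0..} (ghat h Rs)"
  using mono_onD[OF hit_mono]
  unfolding ghat_eq_sum_hit [abs_def]
  by (intro mono_onI mult_left_mono sum_list_mono) auto

lemma ghat_dr: "dr_submodular (ghat h Rs)"
  unfolding dr_submodular_def
proof safe
  fix x y :: "real ^ 'd" and i d assume *: "0 \<le> x" "x \<le> y" "(0::real) < d"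
  let ?e = "d *\<^sub>R axis i 1 :: real ^ 'd"
  have diff: "ghat h Rs (z + ?e) - ghat h Rs z
      = real CARD('v) / real (length Rs) * (\<Sum>R\<leftarrow>Rs. hit h R (z + ?e) - hit h R z)" for z
    by (simp add: ghat_eq_sum_hit sum_list_subtractf right_diff_distrib)
  show "ghat h Rs (y + ?e) - ghat h Rs y \<le> ghat h Rs (x + ?e) - ghat h Rs x"
    unfolding diff using hit_dr *
    by (intro mult_left_mono sum_list_mono) (auto simp: dr_submodular_def)
qed

lemma ghat_lipschitz: "((real CARD('v))\<^sup>2 * Lh)-lipschitz_on {0..} (ghat h Rs)"
proof (rule lipschitz_onI)
  fix x y :: "real ^ 'd" assume xy: "x \<in> {0..}" "y \<in> {0..}"
  let ?c = "real CARD('v) / real (length Rs)"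
  have "dist (ghat h Rs x) (ghat h Rs y) = \<bar>?c * (\<Sum>R\<leftarrow>Rs. hit h R x - hit h R y)\<bar>"
    by (simp add: ghat_eq_sum_hit dist_norm sum_list_subtractf right_diff_distrib)
  also have "\<dots> = ?c * \<bar>\<Sum>R\<leftarrow>Rs. hit h R x - hit h R y\<bar>"
    by (simp add: abs_mult)
  also have "\<dots> \<le> ?c * (\<Sum>R\<leftarrow>Rs. \<bar>hit h R x - hit h R y\<bar>)"
    by (intro mult_left_mono order.trans[OF sum_list_abs]) (auto simp: o_def)
  also have "\<dots> \<le> ?c * (\<Sum>R\<leftarrow>Rs. real CARD('v) * Lh * norm (x - y))"
    using lipschitz_on_normD[OF hit_lipschitz xy] by (intro mult_left_mono sum_list_mono) auto
  also have "\<dots> \<le> (real CARD('v))\<^sup>2 * Lh * norm (x - y)"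
    using Lh_nonneg by (auto simp: sum_list_triv power2_eq_square)
  finally show "dist (ghat h Rs x) (ghat h Rs y) \<le> (real CARD('v))\<^sup>2 * Lh * dist x y"
    by (simp add: dist_norm)
qed (use Lh_nonneg in auto)

lemma ghat_smooth: "smooth (inner_beta Lh \<beta>h Rs) (ghat h Rs)"
proof -
  let ?c = "real CARD('v) / real (length Rs)"
  have "smooth (?c * (\<Sum>R\<leftarrow>Rs. real (card R) * \<beta>h + (real (card R))\<^sup>2 * Lh\<^sup>2)) (\<lambda>x. ?c * (\<Sum>R\<leftarrow>Rs. hit h R x))"
    by (intro smooth_cmult smooth_sum_list hit_smooth) auto
  also have "?c * (\<Sum>R\<leftarrow>Rs. real (card R) * \<beta>h + (real (card R))\<^sup>2 * Lh\<^sup>2) = inner_beta Lh \<beta>h Rs"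
    by (simp add: inner_beta_def rr_moment_def sum_list_addf sum_list_mult_const distrib_left)
       (simp add: mult_ac)
  also have "(\<lambda>x. ?c * (\<Sum>R\<leftarrow>Rs. hit h R x)) = ghat h Rs"
    by (simp add: ghat_eq_sum_hit fun_eq_iff)
  finally show ?thesis .
qed

lemma cim_g_mono: "mono_on {0..} (cim_g Tr h)"
  using mono_onD[OF hit_mono]
  by (auto simp: cim_g_eq_expectation_hit intro!: mono_onI mult_left_mono integral_mono
      integrable_measure_pmf_finite)

lemma cim_g_nonneg: "0 \<le> x \<Longrightarrow> 0 \<le> cim_g Tr h x"
  using hit_range by (auto simp: cim_g_eq_expectation_hit intro!: mult_nonneg_nonneg integral_nonneg)

lemma cim_g_lipschitz: "((real CARD('v))\<^sup>2 * Lh)-lipschitz_on {0..} (cim_g Tr h)"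
proof (rule lipschitz_onI)
  fix x y :: "real ^ 'd" assume xy: "x \<in> {0..}" "y \<in> {0..}"
  have int: "integrable (measure_pmf (rr_set Tr)) f" for f :: "'v set \<Rightarrow> real"
    by (rule integrable_measure_pmf_finite) simp
  have "dist (cim_g Tr h x) (cim_g Tr h y)
      = real CARD('v) * \<bar>measure_pmf.expectation (rr_set Tr) (\<lambda>R. hit h R x - hit h R y)\<bar>"
    by (simp add: cim_g_eq_expectation_hit dist_norm int right_diff_distrib[symmetric] abs_mult)
  also have "\<dots> \<le> real CARD('v) * measure_pmf.expectation (rr_set Tr) (\<lambda>R. \<bar>hit h R x - hit h R y\<bar>)"
    by (intro mult_left_mono integral_abs_bound) auto
  also have "\<dots> \<le> real CARD('v) * measure_pmf.expectation (rr_set Tr) (\<lambda>R. real CARD('v) * Lh * norm (x - y))"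
    using lipschitz_on_normD[OF hit_lipschitz xy] by (intro mult_left_mono integral_mono int) auto
  also have "\<dots> = (real CARD('v))\<^sup>2 * Lh * norm (x - y)"
    by (simp add: power2_eq_square)
  finally show "dist (cim_g Tr h x) (cim_g Tr h y) \<le> (real CARD('v))\<^sup>2 * Lh * dist x y"
    by (simp add: dist_norm)
qed (use Lh_nonneg in auto)

text \<open>The step size is \<open>1 / \<beta>\<close>, so positivity is essential. An RR set
  contains its root, which makes both moments positive, whichever of the two constants is.\<close>

lemma inner_beta_pos:
  assumes "0 < Lh \<or> 0 < \<beta>h" "Rs \<noteq> []" "{} \<notin> set Rs"
  shows "0 < inner_beta Lh \<beta>h Rs"
proof -
  have pos: "0 < rr_moment j Rs" for j
  proof -
    have "0 < (\<Sum>R\<leftarrow>Rs. real (card R) ^ j)"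
      using assms(2,3)
    proof (induction Rs)
      case (Cons R Rs)
      have "0 < card R" using Cons.prems by (auto simp: card_gt_0_iff)
      moreover have "0 \<le> (\<Sum>R\<leftarrow>Rs. real (card R) ^ j)" by (auto intro!: sum_list_nonneg)
      ultimately show ?case by (simp add: add_pos_nonneg)
    qed simp
    thus ?thesis using assms(2) by (simp add: rr_moment_def)
  qed
  from assms(1) show ?thesis
  proof
    assume "0 < Lh"
    thus ?thesis using pos \<beta>h_nonneg unfolding inner_beta_def
      by (intro add_nonneg_pos mult_pos_pos mult_nonneg_nonneg) (auto simp: less_imp_le)
  next
    assume "0 < \<beta>h"
    thus ?thesis using pos unfolding inner_beta_def
      by (intro add_pos_nonneg mult_pos_pos mult_nonneg_nonneg) (auto simp: less_imp_le)
  qed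
qed

end

section \<open>Nets\<close>

lemma is_net_exists:
  fixes P :: "(real ^ 'd) set"
  assumes "bounded P" "0 < r"
  shows "\<exists>N. is_net r P N"
proof -
  have "compact (closure P)" using assms(1) by (simp add: compact_closure)
  then obtain N where N: "finite N" "closure P \<subseteq> (\<Union>x\<in>N. ball x r)"
    using assms(2) unfolding compact_eq_totally_bounded by blast
  have "\<exists>p\<in>N. norm (x - p) \<le> r" if "x \<in> P" for x
    using N(2) that closure_subset[of P] by (force simp: dist_norm norm_minus_commute)
  with N(1) show ?thesis by (auto simp: is_net_def)
qed

lemma covering_number_attained:
  fixes P :: "(real ^ 'd) set"
  assumes "bounded P" "0 < r"
  obtains N where "is_net r P N" "card N = covering_number P r"
proof -
  have "\<exists>N. is_net r P N \<and> card N = covering_number P r"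
    unfolding covering_number_def by (rule LeastI_ex) (use is_net_exists[OF assms] in blast)
  with that show ?thesis by blast
qed

lemma covering_number_pos:
  fixes P :: "(real ^ 'd) set"
  assumes "bounded P" "0 < r" "P \<noteq> {}"
  shows "1 \<le> covering_number P r"
proof -
  obtain N where N: "is_net r P N" "card N = covering_number P r"
    using covering_number_attained[OF assms(1,2)] .
  hence "N \<noteq> {}" "finite N" using assms(3) by (auto simp: is_net_def)
  with N(2) show ?thesis by (simp add: Suc_le_eq card_gt_0_iff flip: N(2))
qed

lemma covering_number_antimono:
  fixes P :: "(real ^ 'd) set"
  assumes "bounded P" "0 < r" "r \<le> r'"
  shows "covering_number P r' \<le> covering_number P r"
proof -
  obtain N where N: "is_net r P N" "card N = covering_number P r"
    using covering_number_attained[OF assms(1,2)] .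
  have "is_net r' P N" using N(1) assms(3) unfolding is_net_def by (meson order.trans)
  thus ?thesis unfolding covering_number_def[of P r'] using N(2) by (auto intro: Least_le)
qed

text \<open>
  The points of a net may lie outside \<open>P\<close>; the metric projection onto \<open>closure P\<close> is nonexpansive,
  so it moves them into \<open>closure P\<close> without increasing the radius.
\<close>

lemma closure_net:
  fixes P :: "(real ^ 'd) set"
  assumes "bounded P" "0 < r" "P \<noteq> {}" "convex P"
  obtains N where "finite N" "N \<subseteq> closure P" "card N \<le> covering_number P r"
    "\<And>x. x \<in> P \<Longrightarrow> \<exists>p\<in>N. norm (x - p) \<le> r"
proof -
  obtain N where N: "is_net r P N" "card N = covering_number P r"
    using covering_number_attained[OF assms(1,2)] .
  let ?C = "closure P"
  have C: "convex ?C" "closed ?C" "?C \<noteq> {}" using assms by (auto simp: convex_closure)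
  show ?thesis
  proof (rule that[of "closest_point ?C ` N"])
    show "finite (closest_point ?C ` N)" using N(1) by (simp add: is_net_def)
    show "closest_point ?C ` N \<subseteq> ?C" using closest_point_in_set C by blast
    show "card (closest_point ?C ` N) \<le> covering_number P r"
      using N by (auto simp: is_net_def intro!: card_image_le simp flip: N(2))
    fix x assume x: "x \<in> P"
    then obtain p where p: "p \<in> N" "norm (x - p) \<le> r" using N(1) by (auto simp: is_net_def)
    have "closest_point ?C x = x" using x closure_subset by (intro closest_point_self) blast
    hence "norm (x - closest_point ?C p) \<le> r"
      using closest_point_lipschitz[OF C, of x p] p(2) by (simp add: dist_norm)
    with p(1) show "\<exists>p\<in>closest_point ?C ` N. norm (x - p) \<le> r" by blast
  qed
qed

section \<open>The proximal gradient algorithm\<close>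

text \<open>First-order optimality without derivatives: the minimiser is compared with the point
  reached by moving a fraction \<open>u\<close> towards \<open>y\<close>. The linear gain
  \<open>u * a\<close> would beat the quadratic cost for small \<open>u\<close>.\<close>

lemma is_prox_variational:
  fixes P :: "(real ^ 'd) set"
  assumes "is_prox P \<phi> w x" "convex_on P \<phi>" "y \<in> P"
  shows "(w - x) \<bullet> (y - x) \<le> \<phi> y - \<phi> x"
proof (rule ccontr)
  define c where "c = (w - x) \<bullet> (y - x)"
  define a where "a = c - (\<phi> y - \<phi> x)"
  define N where "N = (norm (y - x))\<^sup>2"
  assume "\<not> ?thesis"
  hence a: "0 < a" by (simp add: a_def c_def)
  have N: "0 \<le> N" by (simp add: N_def)
  \<comment> \<open>At most 1, to stay on the segment, and small enough that
    \<open>u * N / 2 < a\<close>.\<close>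
  define u where "u = min 1 (a / (N + 1))"
  have u: "0 < u" "u \<le> 1" using a N by (auto simp: u_def)
  have x: "x \<in> P" and min: "\<And>y. y \<in> P \<Longrightarrow> \<phi> x + (norm (w - x))\<^sup>2 / 2 \<le> \<phi> y + (norm (w - y))\<^sup>2 / 2"
    using assms(1) by (auto simp: is_prox_def is_arg_min_linorder)
  let ?z = "(1 - u) *\<^sub>R x + u *\<^sub>R y"
  have "convex P" using assms(2) by (rule convex_on_imp_convex)
  hence "?z \<in> P" using x assms(3) u by (intro convexD) auto
  hence "\<phi> x + (norm (w - x))\<^sup>2 / 2 \<le> \<phi> ?z + (norm (w - ?z))\<^sup>2 / 2" by (rule min)
  also have "\<phi> ?z \<le> (1 - u) * \<phi> x + u * \<phi> y"
    by (rule convex_onD[OF assms(2)]) (use u x assms(3) in auto)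
  also have "w - ?z = (w - x) - u *\<^sub>R (y - x)" by (simp add: algebra_simps)
  also have "(norm ((w - x) - u *\<^sub>R (y - x)))\<^sup>2
      = (norm (w - x))\<^sup>2 - 2 * u * c + u\<^sup>2 * N"
    unfolding N_def c_def power2_norm_eq_inner
    by (simp add: inner_diff_left inner_diff_right inner_commute power2_eq_square algebra_simps)
  finally have "u * a \<le> u * (u * N / 2)"
    by (simp add: a_def field_simps power2_eq_square[of u])
  hence "a \<le> u * N / 2" using u(1) by simp
  also have "u * N / 2 \<le> a / (N + 1) * N / 2"
    using N by (intro divide_right_mono mult_right_mono) (auto simp: u_def)
  also have "\<dots> < a" using a N by (simp add: field_simps add_nonneg_pos)
  finally show False by simp
qed

lemma inner_result_mem:
  assumes "inner_result P s h Lh \<beta>h \<Delta> \<epsilon> Rs y"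
  shows "y \<in> P"
proof -
  from assms obtain x t where x: "x 0 \<in> P" and t: "t \<le> nat \<lceil>3 * inner_beta Lh \<beta>h Rs * \<Delta>\<^sup>2 / (4 * \<epsilon>)\<rceil>"
    and y: "y = x t"
    and prox: "\<And>t. t < nat \<lceil>3 * inner_beta Lh \<beta>h Rs * \<Delta>\<^sup>2 / (4 * \<epsilon>)\<rceil> \<Longrightarrow> x (Suc t) \<in> P"
    by (auto simp: inner_result_def Let_def is_arg_max_def is_prox_def is_arg_min_def)
  show ?thesis using x t prox[of "t - 1"] unfolding y by (cases t) auto
qed

context activation
begin

text \<open>
  One proximal step satisfies
  \<open>G x\<^sub>t + G x\<^sub>t\<^sub>+\<^sub>1 + s x\<^sub>t\<^sub>+\<^sub>1 \<ge> G z + s z - \<beta>/2 (\<parallel>x\<^sub>t - z\<parallel>\<^sup>2 - \<parallel>x\<^sub>t\<^sub>+\<^sub>1 - z\<parallel>\<^sup>2)\<close>;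
  the sum over \<open>t\<close> telescopes.
\<close>

lemma inner_result_approx:
  assumes res: "inner_result P s h Lh \<beta>h \<Delta> \<epsilon> Rs y"
    and P: "P \<subseteq> {0..}" and s_concave: "concave_on P s" and s_nonneg: "\<And>x. x \<in> P \<Longrightarrow> 0 \<le> s x"
    and diam: "\<And>x y. x \<in> P \<Longrightarrow> y \<in> P \<Longrightarrow> norm (x - y) \<le> \<Delta>"
    and eps: "0 < \<epsilon>" and beta: "0 < inner_beta Lh \<beta>h Rs" and z: "z \<in> P"
  shows "(ghat h Rs z + s z) / 2 - \<epsilon> / 3 \<le> ghat h Rs y + s y"
proof -
  define \<beta> where "\<beta> = inner_beta Lh \<beta>h Rs"
  define T where "T = nat \<lceil>3 * \<beta> * \<Delta>\<^sup>2 / (4 * \<epsilon>)\<rceil>"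
  define G where "G = ghat h Rs"
  have b: "0 < \<beta>" using beta by (simp add: \<beta>_def)
  note yP = inner_result_mem[OF res]
  have "0 \<le> \<Delta>" using diam[OF z z] by simp
  then consider "\<Delta> = 0" | "0 < \<Delta>" by linarith
  thus ?thesis
  proof cases
    \<comment> \<open>Here the algorithm makes no step at all; the claim holds because
      \<open>P\<close> is a single point.\<close>
    case 1
    hence zy: "z = y" using diam[OF z yP] by simp
    have "0 \<le> ghat h Rs z" "0 \<le> s z" using z P s_nonneg ghat_nonneg by auto
    hence "0 \<le> ghat h Rs y + s y" unfolding zy by (rule add_nonneg_nonneg)
    hence "(ghat h Rs y + s y) / 2 - \<epsilon> / 3 \<le> ghat h Rs y + s y" using eps by (simp add: field_simps)
    thus ?thesis unfolding zy .
  next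
    case 2
    from res obtain x t0 where x0: "x 0 \<in> P"
      and prox: "\<And>t. t < T \<Longrightarrow> is_prox P (\<lambda>z. - (1 / \<beta>) * s z) (x t + (1 / \<beta>) *\<^sub>R grad G (x t)) (x (Suc t))"
      and best: "\<And>t. t \<le> T \<Longrightarrow> G (x t) + s (x t) \<le> G y + s y"
      by (auto simp: inner_result_def Let_def is_arg_max_linorder \<beta>_def T_def G_def)
    have T: "3 * \<beta> * \<Delta>\<^sup>2 / (4 * \<epsilon>) \<le> real T" "0 < real T"
    proof -
      show 1: "3 * \<beta> * \<Delta>\<^sup>2 / (4 * \<epsilon>) \<le> real T" unfolding T_def by linarith
      have "0 < 3 * \<beta> * \<Delta>\<^sup>2 / (4 * \<epsilon>)" using b 2 eps by simp
      with 1 show "0 < real T" by linarith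
    qed
    have xP: "x t \<in> P" if "t \<le> T" for t
      using x0 prox[of "t - 1"] that by (cases t) (auto simp: is_prox_def is_arg_min_def)
    have step: "G z + s z - \<beta> / 2 * ((norm (x t - z))\<^sup>2 - (norm (x (Suc t) - z))\<^sup>2)
        \<le> 2 * (G y + s y)" if t: "t < T" for t
    proof -
      define u v where "u = x t" and "v = x (Suc t)"
      have u: "u \<in> P" "0 \<le> u" and v: "v \<in> P" "0 \<le> v" and z0: "0 \<le> z"
        using xP[of t] xP[of "Suc t"] t P z by (auto simp: u_def v_def)
      have cvx: "convex_on P (\<lambda>z. - (1 / \<beta>) * s z)"
        using convex_on_cmul[of "1 / \<beta>" P "\<lambda>x. - s x"] s_concave b by (simp add: concave_on_def)
      have "(u + (1 / \<beta>) *\<^sub>R grad G u - v) \<bullet> (z - v) \<le> - (1 / \<beta>) * s z - (- (1 / \<beta>) * s v)"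
        using is_prox_variational[OF prox[OF t] cvx z] by (simp add: u_def v_def)
      hence "\<beta> * ((u + (1 / \<beta>) *\<^sub>R grad G u - v) \<bullet> (z - v)) \<le> \<beta> * (- (1 / \<beta>) * s z - (- (1 / \<beta>) * s v))"
        using b by (intro mult_left_mono) auto
      moreover have "\<beta> * ((u + (1 / \<beta>) *\<^sub>R grad G u - v) \<bullet> (z - v))
          = \<beta> * ((u - v) \<bullet> (z - v)) + grad G u \<bullet> (z - v)"
        using b by (simp add: inner_add_left inner_diff_left algebra_simps)
      moreover have "\<beta> * (- (1 / \<beta>) * s z - (- (1 / \<beta>) * s v)) = s v - s z"
        using b by (simp add: field_simps)
      ultimately have 1: "\<beta> * ((u - v) \<bullet> (z - v)) + grad G u \<bullet> (z - v) \<le> s v - s z" by simp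
      have 2: "G u + grad G u \<bullet> (v - u) - \<beta> / 2 * (norm (v - u))\<^sup>2 \<le> G v"
        unfolding G_def \<beta>_def by (rule smooth_lower_bound[OF ghat_smooth u(2) v(2)])
      have 3: "G z - 2 * G u \<le> grad G u \<bullet> (z - u)"
        unfolding G_def
        by (rule dr_submodular_grad_ge[OF smooth_has_grad[OF ghat_smooth] ghat_dr ghat_mono ghat_nonneg u(2) z0])
      have 4: "grad G u \<bullet> (z - u) = grad G u \<bullet> (z - v) + grad G u \<bullet> (v - u)"
        by (simp add: inner_diff_right)
      \<comment> \<open>Three-point identity. It supplies the telescoping difference, and with step
        size \<open>1 / \<beta>\<close> its term in \<open>u - v\<close> cancels the quadratic loss
        in the descent inequality.\<close>
      have 5: "2 * ((u - v) \<bullet> (z - v)) = (norm (u - v))\<^sup>2 + (norm (v - z))\<^sup>2 - (norm (u - z))\<^sup>2"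
        unfolding power2_norm_eq_inner by (simp add: inner_diff_left inner_diff_right inner_commute)
      have "\<beta> * ((u - v) \<bullet> (z - v)) = \<beta> / 2 * ((norm (v - u))\<^sup>2 + (norm (v - z))\<^sup>2 - (norm (u - z))\<^sup>2)"
        using 5 by (simp add: norm_minus_commute[of v u])
      hence "G z + s z - \<beta> / 2 * ((norm (u - z))\<^sup>2 - (norm (v - z))\<^sup>2) \<le> G u + (G v + s v)"
        using 1 2 3 4 by (simp add: algebra_simps)
      \<comment> \<open>Adding \<open>s u \<ge> 0\<close> completes the values of both iterates, and
        each is at most the best one.\<close>
      also have "\<dots> \<le> 2 * (G y + s y)"
        using best[of t] best[of "Suc t"] t s_nonneg[OF u(1)] by (simp add: u_def v_def)
      finally show ?thesis by (simp add: u_def v_def)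
    qed
    have "real T * (G z + s z) - \<beta> / 2 * ((norm (x 0 - z))\<^sup>2 - (norm (x T - z))\<^sup>2)
        = (\<Sum>t<T. G z + s z - \<beta> / 2 * ((norm (x t - z))\<^sup>2 - (norm (x (Suc t) - z))\<^sup>2))"
      using sum_lessThan_telescope'[of "\<lambda>t. (norm (x t - z))\<^sup>2" T]
      by (simp only: sum_subtractf[of _ "\<lambda>t. \<beta> / 2 * _ t"] sum_distrib_left[symmetric] sum_constant
          card_lessThan)
    also have "\<dots> \<le> (\<Sum>t<T. 2 * (G y + s y))" by (intro sum_mono step) simp
    also have "\<dots> = 2 * real T * (G y + s y)" by simp
    finally have "real T * (G z + s z) - \<beta> / 2 * ((norm (x 0 - z))\<^sup>2 - (norm (x T - z))\<^sup>2)
        \<le> 2 * real T * (G y + s y)" .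
    moreover have "\<beta> / 2 * ((norm (x 0 - z))\<^sup>2 - (norm (x T - z))\<^sup>2) \<le> \<beta> / 2 * \<Delta>\<^sup>2"
    proof (rule mult_left_mono)
      show "(norm (x 0 - z))\<^sup>2 - (norm (x T - z))\<^sup>2 \<le> \<Delta>\<^sup>2"
        using power_mono[OF diam[OF x0 z] norm_ge_zero, of 2] zero_le_power2[of "norm (x T - z)"] by linarith
    qed (use b in simp)
    \<comment> \<open>The number of steps is chosen for this: per step the telescoped term costs at
      most 2\<epsilon>/3, which the final halving turns into \<epsilon>/3.\<close>
    moreover have "\<beta> / 2 * \<Delta>\<^sup>2 \<le> real T * (2 * \<epsilon> / 3)"
      using T(1) eps by (simp add: field_simps)
    ultimately have "real T * (G z + s z) \<le> real T * (2 * (G y + s y) + 2 * \<epsilon> / 3)"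
      by (simp add: algebra_simps)
    hence "G z + s z \<le> 2 * (G y + s y) + 2 * \<epsilon> / 3" using T(2) by simp
    thus ?thesis by (simp add: G_def field_simps)
  qed
qed

section \<open>Concentration of \<open>ghat\<close> at a fixed point, and the union bounds\<close>

lemma prob_ghat_upper_tail:
  fixes Tr :: "'v \<Rightarrow> 'v set pmf"
  assumes x: "0 \<le> x" and g: "cim_g Tr h x \<le> M" and M: "0 < M" and t: "0 \<le> t" and N: "0 < N"
  shows "measure_pmf.prob (replicate_pmf N (rr_set Tr)) {Rs. cim_g Tr h x + t \<le> ghat h Rs x}
           \<le> exp (- (real N * t\<^sup>2 / (real CARD('v) * (2 * M + 2 * t / 3))))"
proof -
  let ?n = "real CARD('v)" and ?p = "replicate_pmf N (rr_set Tr)"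
  let ?m = "measure_pmf.expectation (rr_set Tr) (\<lambda>R. hit h R x)"
  have gm: "cim_g Tr h x = ?n * ?m" by (rule cim_g_eq_expectation_hit)
  have "measure_pmf.prob ?p {Rs. cim_g Tr h x + t \<le> ghat h Rs x}
      \<le> measure_pmf.prob ?p {Rs. (\<Sum>R\<leftarrow>Rs. hit h R x) \<ge> real N * (?m + t / ?n)}"
  proof (rule measure_pmf.finite_measure_mono_AE)
    show "AE Rs in measure_pmf ?p. Rs \<in> {Rs. cim_g Tr h x + t \<le> ghat h Rs x}
        \<longrightarrow> Rs \<in> {Rs. (\<Sum>R\<leftarrow>Rs. hit h R x) \<ge> real N * (?m + t / ?n)}"
      using N by (auto simp: AE_measure_pmf_iff set_replicate_pmf ghat_eq_sum_hit gm field_simps)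
  qed simp
  also have "\<dots> \<le> exp (- (real N * (t / ?n)\<^sup>2 / (2 * (M / ?n) + 2 * (t / ?n) / 3)))"
  proof (rule replicate_pmf_upper_tail)
    show "?m \<le> M / ?n" using g by (simp add: gm field_simps)
  qed (use hit_range[OF x] M t in auto)
  also have "real N * (t / ?n)\<^sup>2 / (2 * (M / ?n) + 2 * (t / ?n) / 3) = real N * t\<^sup>2 / (?n * (2 * M + 2 * t / 3))"
    using M t by (simp add: power2_eq_square divide_simps)
  finally show ?thesis .
qed

lemma prob_ghat_lower_tail:
  fixes Tr :: "'v \<Rightarrow> 'v set pmf"
  assumes x: "0 \<le> x" and g: "cim_g Tr h x \<le> M" and M: "0 < M" and t: "0 \<le> t" and N: "0 < N"
  shows "measure_pmf.prob (replicate_pmf N (rr_set Tr)) {Rs. ghat h Rs x \<le> cim_g Tr h x - t}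
           \<le> exp (- (real N * t\<^sup>2 / (2 * real CARD('v) * M)))"
proof -
  let ?n = "real CARD('v)" and ?p = "replicate_pmf N (rr_set Tr)"
  let ?m = "measure_pmf.expectation (rr_set Tr) (\<lambda>R. hit h R x)"
  have gm: "cim_g Tr h x = ?n * ?m" by (rule cim_g_eq_expectation_hit)
  have "measure_pmf.prob ?p {Rs. ghat h Rs x \<le> cim_g Tr h x - t}
      \<le> measure_pmf.prob ?p {Rs. (\<Sum>R\<leftarrow>Rs. hit h R x) \<le> real N * (?m - t / ?n)}"
  proof (rule measure_pmf.finite_measure_mono_AE)
    show "AE Rs in measure_pmf ?p. Rs \<in> {Rs. ghat h Rs x \<le> cim_g Tr h x - t}
        \<longrightarrow> Rs \<in> {Rs. (\<Sum>R\<leftarrow>Rs. hit h R x) \<le> real N * (?m - t / ?n)}"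
      using N by (auto simp: AE_measure_pmf_iff set_replicate_pmf ghat_eq_sum_hit gm field_simps)
  qed simp
  also have "\<dots> \<le> exp (- (real N * (t / ?n)\<^sup>2 / (2 * (M / ?n))))"
  proof (rule replicate_pmf_lower_tail)
    show "?m \<le> M / ?n" using g by (simp add: gm field_simps)
  qed (use hit_range[OF x] M t in auto)
  also have "real N * (t / ?n)\<^sup>2 / (2 * (M / ?n)) = real N * t\<^sup>2 / (2 * ?n * M)"
    using M by (simp add: power2_eq_square divide_simps)
  finally show ?thesis .
qed

end

lemma prob_Bex_le:
  assumes "finite N" "real (card N) \<le> K" "\<And>q. q \<in> N \<Longrightarrow> measure_pmf.prob p {x. X q x} \<le> b" "0 \<le> b"
  shows "measure_pmf.prob p {x. \<exists>q\<in>N. X q x} \<le> K * b"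
proof -
  have "{x. \<exists>q\<in>N. X q x} = (\<Union>q\<in>N. {x. X q x})" by blast
  hence "measure_pmf.prob p {x. \<exists>q\<in>N. X q x} \<le> (\<Sum>q\<in>N. measure_pmf.prob p {x. X q x})"
    using assms(1) by (simp add: measure_pmf.finite_measure_subadditive_finite)
  also have "\<dots> \<le> (\<Sum>q\<in>N. b)" by (intro sum_mono assms(3))
  also have "\<dots> \<le> K * b" using assms(2,4) by (simp add: mult_right_mono)
  finally show ?thesis .
qed

text \<open>
  Since \<open>\<theta>\<close> is nondecreasing, the sets held in round \<open>i\<close> are distributed as \<open>\<theta> i\<close> independent
  RR sets when the search is continued regardless of the stopping test, so a union bound over
  the rounds applies.
\<close>

lemma prob_search_le:
  assumes "\<And>r. i \<le> r \<Longrightarrow> r < i + j \<Longrightarrow> \<theta> (r - 1) \<le> \<theta> r" and "good 1"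
  shows "measure_pmf.prob (replicate_pmf (\<theta> (i - 1)) rr \<bind> search rr A Fhat \<theta> \<xi> \<kappa> i j) {LB. \<not> good LB}
    \<le> (\<Sum>r\<in>{i..<i + j}. measure_pmf.prob (replicate_pmf (\<theta> r) rr)
          {Rs. \<kappa> * \<xi> r \<le> Fhat Rs (A Rs) \<and> \<not> good (Fhat Rs (A Rs) / \<kappa>)})"
  using assms(1)
proof (induction j arbitrary: i)
  case 0
  show ?case using assms(2) by (simp add: prob_bind_pmf)
next
  case (Suc j)
  let ?C = "\<lambda>r. {Rs. \<kappa> * \<xi> r \<le> Fhat Rs (A Rs) \<and> \<not> good (Fhat Rs (A Rs) / \<kappa>)}"
  let ?f = "\<lambda>Rs. if \<kappa> * \<xi> i \<le> Fhat Rs (A Rs) then return_pmf (Fhat Rs (A Rs) / \<kappa>)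
                  else search rr A Fhat \<theta> \<xi> \<kappa> (Suc i) j Rs"
  \<comment> \<open>Natural subtraction truncates; monotonicity of \<open>\<theta>\<close> makes the
    decomposition exact.\<close>
  have "\<theta> i = \<theta> (i - 1) + (\<theta> i - \<theta> (i - 1))" using Suc.prems[of i] by simp
  hence "replicate_pmf (\<theta> i) rr = replicate_pmf (\<theta> (i - 1)) rr \<bind>
      (\<lambda>Rs. replicate_pmf (\<theta> i - \<theta> (i - 1)) rr \<bind> (\<lambda>new. return_pmf (Rs @ new)))"
    by (metis replicate_pmf_distrib)
  moreover have rec: "search rr A Fhat \<theta> \<xi> \<kappa> i (Suc j)
      = (\<lambda>Rs. replicate_pmf (\<theta> i - \<theta> (i - 1)) rr \<bind> (\<lambda>new. ?f (Rs @ new)))"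
    by (simp add: fun_eq_iff Let_def)
  ultimately have "replicate_pmf (\<theta> (i - 1)) rr \<bind> search rr A Fhat \<theta> \<xi> \<kappa> i (Suc j) = replicate_pmf (\<theta> i) rr \<bind> ?f"
    unfolding rec by (simp only: bind_assoc_pmf bind_return_pmf)
  moreover have "measure_pmf.prob (replicate_pmf (\<theta> i) rr \<bind> ?f) {LB. \<not> good LB}
      \<le> measure_pmf.prob (replicate_pmf (\<theta> i) rr) (?C i) +
        (measure_pmf.prob (replicate_pmf (\<theta> i) rr \<bind> search rr A Fhat \<theta> \<xi> \<kappa> (Suc i) j) {LB. \<not> good LB} + 0)"
    by (rule prob_bind_pmf_le) (auto simp: indicator_def)
  moreover have "measure_pmf.prob (replicate_pmf (\<theta> i) rr \<bind> search rr A Fhat \<theta> \<xi> \<kappa> (Suc i) j) {LB. \<not> good LB}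
      \<le> (\<Sum>r\<in>{Suc i..<Suc i + j}. measure_pmf.prob (replicate_pmf (\<theta> r) rr) (?C r))"
    using Suc.IH[of "Suc i"] Suc.prems by simp
  moreover have "{i..<i + Suc j} = insert i {Suc i..<Suc i + j}" by auto
  ultimately show ?case by (simp del: search.simps)
qed

section \<open>Sampling errors of the search and of the final round\<close>

lemma mult_divide_mult_cancel: "(a :: real) \<noteq> 0 \<Longrightarrow> a * (b / a * c) = b * c"
  by simp

text \<open>The assumption \<open>opt_ge_1\<close> turns the additive error \<epsilon>/3 of the
  inner algorithm into a relative one; the same bound makes the value 1, returned when no round
  passes the test, an admissible \<open>LB\<close>.\<close>

locale proximal_ris = activation h Lh \<beta>h
  for h :: "'v::finite \<Rightarrow> real ^ 'd \<Rightarrow> real" and Lh \<beta>h :: real +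
  fixes Tr :: "'v \<Rightarrow> 'v set pmf" and P :: "(real ^ 'd) set" and s :: "real ^ 'd \<Rightarrow> real"
    and Ls \<Delta> \<epsilon> :: real and A :: "'v set list \<Rightarrow> real ^ 'd"
  assumes P_orthant: "P \<subseteq> {0..}"
    and s_concave: "concave_on P s"
    and s_nonneg: "x \<in> P \<Longrightarrow> 0 \<le> s x"
    and s_lip: "Ls-lipschitz_on P s"
    and diam: "x \<in> P \<Longrightarrow> y \<in> P \<Longrightarrow> norm (x - y) \<le> \<Delta>"
    and eps_pos: "0 < \<epsilon>"
    and Lh_or_\<beta>h: "0 < Lh \<or> 0 < \<beta>h"
    and A: "inner_result P s h Lh \<beta>h \<Delta> \<epsilon> Rs (A Rs)"
    and opt_ge_1: "1 \<le> cim_opt P (\<lambda>x. cim_g Tr h x + s x)"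
begin

abbreviation g :: "real ^ 'd \<Rightarrow> real" where "g \<equiv> cim_g Tr h"
abbreviation F :: "real ^ 'd \<Rightarrow> real" where "F \<equiv> \<lambda>x. g x + s x"
abbreviation OPT :: real where "OPT \<equiv> cim_opt P F"
lemma A_mem: "A Rs \<in> P"
  by (rule inner_result_mem[OF A])

lemma P_nonempty: "P \<noteq> {}"
  using A_mem[of "[]"] by blast

lemma P_nonneg: "x \<in> P \<Longrightarrow> 0 \<le> x"
  using P_orthant by auto

lemma P_convex: "convex P"
  using s_concave unfolding concave_on_def by (rule convex_on_imp_convex)

lemma P_bounded: "bounded P"
  unfolding bounded_def using A_mem[of "[]"] diam by (auto simp: dist_norm)

lemma Ls_nonneg: "0 \<le> Ls"
  using s_lip by (rule lipschitz_on_nonneg)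

lemma F_lipschitz: "((real CARD('v))\<^sup>2 * Lh + Ls)-lipschitz_on P F"
  by (intro lipschitz_on_add s_lip lipschitz_on_subset[OF cim_g_lipschitz P_orthant])

lemma F_bdd_above: "bdd_above (F ` P)"
proof (rule bdd_aboveI2)
  fix x assume x: "x \<in> P"
  have "\<bar>F x - F (A [])\<bar> \<le> ((real CARD('v))\<^sup>2 * Lh + Ls) * norm (x - A [])"
    using lipschitz_on_normD[OF F_lipschitz x A_mem[of "[]"]] by simp
  also have "\<dots> \<le> ((real CARD('v))\<^sup>2 * Lh + Ls) * \<Delta>"
    using diam[OF x A_mem[of "[]"]] Lh_nonneg Ls_nonneg by (intro mult_left_mono) auto
  finally show "F x \<le> F (A []) + ((real CARD('v))\<^sup>2 * Lh + Ls) * \<Delta>" by linarith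
qed

lemma F_le_OPT: "x \<in> P \<Longrightarrow> F x \<le> OPT"
  unfolding cim_opt_def by (rule cSUP_upper[OF _ F_bdd_above])

lemma near_optimal:
  assumes "a < OPT"
  obtains x where "x \<in> P" "a < F x"
  using assms less_cSUP_iff[OF P_nonempty F_bdd_above] that unfolding cim_opt_def by blast

lemma F_nonneg: "x \<in> P \<Longrightarrow> 0 \<le> F x"
  using cim_g_nonneg P_nonneg s_nonneg by (simp add: add_nonneg_nonneg)

lemma closure_nonneg: "q \<in> closure P \<Longrightarrow> 0 \<le> q"
  using closure_minimal[OF P_orthant] closed_interval_right_cart[of "0 :: real ^ 'd"]
  by (auto simp: less_eq_vec_def atLeast_def)

text \<open>For \<open>q \<in> P\<close> this is \<open>s y \<le> s q + Ls \<parallel>y - q\<parallel>\<close> together with \<open>F q \<le> OPT\<close>.\<close>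

lemma closure_bounds:
  assumes q: "q \<in> closure P"
  shows "g q \<le> OPT" and "y \<in> P \<Longrightarrow> s y \<le> OPT - g q + Ls * norm (y - q)"
proof -
  let ?L = "(real CARD('v))\<^sup>2 * Lh"
  have L: "0 \<le> ?L" using Lh_nonneg by simp
  have limit: "a \<le> b" if "0 \<le> K" "\<And>e. 0 < e \<Longrightarrow> a \<le> b + K * e" for a b K :: real
  proof (rule field_le_epsilon)
    fix e :: real assume e: "0 < e"
    have "a \<le> b + K * (e / (K + 1))" by (rule that(2)) (use e that(1) in auto)
    also have "K * (e / (K + 1)) \<le> e" using e that(1) by (simp add: field_simps)
    finally show "a \<le> b + e" by simp
  qed
  have near: "\<exists>p\<in>P. g q \<le> g p + ?L * e \<and> norm (p - q) \<le> e" if e: "0 < e" for e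
  proof -
    from q e obtain p where p: "p \<in> P" "dist p q < e" by (auto simp: closure_approachable)
    have "g q - g p \<le> ?L * norm (q - p)"
      using lipschitz_on_normD[OF cim_g_lipschitz[of Tr], of q p] P_nonneg[OF p(1)] closure_nonneg[OF q] by auto
    also have "\<dots> \<le> ?L * e" using p(2) L by (intro mult_left_mono) (auto simp: dist_norm norm_minus_commute)
    finally show ?thesis using p by (intro bexI[of _ p]) (auto simp: dist_norm)
  qed
  show "g q \<le> OPT"
  proof (rule limit[OF L])
    fix e :: real assume "0 < e"
    from near[OF this] obtain p where p: "p \<in> P" "g q \<le> g p + ?L * e" by blast
    thus "g q \<le> OPT + ?L * e" using F_le_OPT[OF p(1)] s_nonneg[OF p(1)] by linarith
  qed
  assume y: "y \<in> P"
  show "s y \<le> OPT - g q + Ls * norm (y - q)"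
  proof (rule limit[of "?L + Ls"])
    fix e :: real assume "0 < e"
    from near[OF this] obtain p where p: "p \<in> P" "g q \<le> g p + ?L * e" "norm (p - q) \<le> e" by blast
    have "s y - s p \<le> Ls * norm (y - p)" using lipschitz_on_normD[OF s_lip y p(1)] by simp
    also have "\<dots> \<le> Ls * (norm (y - q) + e)"
      using p(3) Ls_nonneg norm_triangle_ineq[of "y - q" "q - p"]
      by (intro mult_left_mono) (auto simp: norm_minus_commute)
    finally show "s y \<le> OPT - g q + Ls * norm (y - q) + (?L + Ls) * e"
      using F_le_OPT[OF p(1)] p(2) by (simp add: algebra_simps)
  qed (use L Ls_nonneg in simp)
qed

text \<open>In \<open>\<kappa>\<close> the summand \<epsilon>/3 pays for moving from the output to
  its net point and \<open>\<epsilon>'\<close> is the deviation left there. Only \<open>ghat\<close>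
  and \<open>s\<close> are moved, since \<open>closure_bounds\<close> relates \<open>s\<close> at
  the output to \<open>g\<close> at the net point; hence the radius is divided by a single Lipschitz
  constant.\<close>

lemma prob_search_round_le:
  assumes L: "0 < (real CARD('v))\<^sup>2 * Lh + Ls" and x: "0 < x" and N: "0 < N"
    and \<epsilon>': "\<epsilon>' = sqrt 2 * \<epsilon> / 3" and \<kappa>: "\<kappa> = 1 + sqrt 2 * \<epsilon> / 3 + \<epsilon> / 3"
  shows "measure_pmf.prob (replicate_pmf N (rr_set Tr))
      {Rs. \<kappa> * x \<le> ghat h Rs (A Rs) + s (A Rs) \<and>
           \<not> (0 < (ghat h Rs (A Rs) + s (A Rs)) / \<kappa> \<and> (ghat h Rs (A Rs) + s (A Rs)) / \<kappa> \<le> OPT)}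
    \<le> real (covering_number P ((\<epsilon> / 3) / ((real CARD('v))\<^sup>2 * Lh + Ls) * x))
        * exp (- (real N * (\<epsilon>'\<^sup>2 * x) / (real CARD('v) * (2 + 2 / 3 * \<epsilon>'))))"
    (is "measure_pmf.prob ?p ?E \<le> real (covering_number P ?r) * exp (- ?b)")
proof -
  let ?L = "(real CARD('v))\<^sup>2 * Lh + Ls"
  have r: "0 < ?r" using eps_pos L x by simp
  have eps': "0 < \<epsilon>'" using eps_pos by (simp add: \<epsilon>')
  have kpos: "0 < \<kappa>" using eps_pos by (simp add: \<kappa> add_pos_pos)
  \<comment> \<open>A harmful round exceeds both \<open>\<kappa> * x\<close> and
    \<open>\<kappa> * OPT\<close>, and \<open>M\<close> also bounds \<open>g\<close> on the net. The
    exponent grows linearly in \<open>M\<close>, so it is at least its value at \<open>x\<close>,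
    for which the sample size is made.\<close>
  define M where "M = max x OPT"
  have M: "0 < M" "x \<le> M" "OPT \<le> M" using x by (auto simp: M_def)
  obtain Q where Q: "finite Q" "Q \<subseteq> closure P" "card Q \<le> covering_number P ?r"
    "\<And>x. x \<in> P \<Longrightarrow> \<exists>p\<in>Q. norm (x - p) \<le> ?r"
    using closure_net[OF P_bounded r P_nonempty P_convex] by blast
  have "?E \<subseteq> {Rs. \<exists>q\<in>Q. g q + \<epsilon>' * M \<le> ghat h Rs q}"
  proof
    fix Rs
    let ?y = "A Rs"
    assume "Rs \<in> ?E"
    hence pass: "\<kappa> * x \<le> ghat h Rs ?y + s ?y"
      and bad: "\<not> (0 < (ghat h Rs ?y + s ?y) / \<kappa> \<and> (ghat h Rs ?y + s ?y) / \<kappa> \<le> OPT)"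
      by auto
    have "0 < \<kappa> * x" using kpos x by simp
    hence "0 < ghat h Rs ?y + s ?y" using pass by linarith
    hence "\<kappa> * OPT < ghat h Rs ?y + s ?y" using bad kpos by (simp add: field_simps)
    with pass have "\<kappa> * M \<le> ghat h Rs ?y + s ?y" by (auto simp: M_def max_def)
    obtain q where q: "q \<in> Q" "norm (?y - q) \<le> ?r" using Q(4)[OF A_mem] by blast
    have qc: "q \<in> closure P" using q Q by blast
    have "ghat h Rs ?y - ghat h Rs q \<le> (real CARD('v))\<^sup>2 * Lh * norm (?y - q)"
      using lipschitz_on_normD[OF ghat_lipschitz, of ?y q Rs] P_nonneg[OF A_mem[of Rs]] closure_nonneg[OF qc]
      by auto
    moreover have "s ?y \<le> OPT - g q + Ls * norm (?y - q)"
      by (rule closure_bounds(2)[OF qc A_mem])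
    moreover have "?L * norm (?y - q) \<le> \<epsilon> / 3 * x"
    proof -
      have "?L * norm (?y - q) \<le> ?L * ?r" using q(2) L by (intro mult_left_mono) auto
      also have "?L * ?r = \<epsilon> / 3 * x" by (rule mult_divide_mult_cancel) (use L in linarith)
      finally show ?thesis .
    qed
    moreover have "\<epsilon> / 3 * x \<le> \<epsilon> / 3 * M" using M eps_pos by (intro mult_left_mono) auto
    moreover have "\<kappa> * M = M + \<epsilon>' * M + \<epsilon> / 3 * M" by (simp add: \<kappa> \<epsilon>' algebra_simps)
    ultimately have "g q + \<epsilon>' * M \<le> ghat h Rs q"
      using \<open>\<kappa> * M \<le> ghat h Rs ?y + s ?y\<close> M(3) by (simp add: distrib_right)
    with q(1) show "Rs \<in> {Rs. \<exists>q\<in>Q. g q + \<epsilon>' * M \<le> ghat h Rs q}" by blast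
  qed
  hence "measure_pmf.prob ?p ?E \<le> measure_pmf.prob ?p {Rs. \<exists>q\<in>Q. g q + \<epsilon>' * M \<le> ghat h Rs q}"
    by (intro measure_pmf.finite_measure_mono) auto
  also have "\<dots> \<le> real (covering_number P ?r) * exp (- ?b)"
  proof (rule prob_Bex_le)
    fix q assume "q \<in> Q"
    hence qc: "q \<in> closure P" using Q by blast
    have "measure_pmf.prob ?p {Rs. g q + \<epsilon>' * M \<le> ghat h Rs q}
        \<le> exp (- (real N * (\<epsilon>' * M)\<^sup>2 / (real CARD('v) * (2 * M + 2 * (\<epsilon>' * M) / 3))))"
      using closure_nonneg[OF qc] closure_bounds(1)[OF qc] M eps' N
      by (intro prob_ghat_upper_tail) auto
    also have "(2 * M + 2 * (\<epsilon>' * M) / 3) = (2 + 2 / 3 * \<epsilon>') * M" by (simp add: algebra_simps)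
    also have "real N * (\<epsilon>' * M)\<^sup>2 / (real CARD('v) * ((2 + 2 / 3 * \<epsilon>') * M))
        = real N * (\<epsilon>'\<^sup>2 * M) / (real CARD('v) * (2 + 2 / 3 * \<epsilon>'))"
      using M(1) by (simp add: power2_eq_square)
    also have "exp (- (real N * (\<epsilon>'\<^sup>2 * M) / (real CARD('v) * (2 + 2 / 3 * \<epsilon>')))) \<le> exp (- ?b)"
      using M(2) eps' by (auto intro!: divide_right_mono mult_left_mono)
    finally show "measure_pmf.prob ?p {Rs. g q + \<epsilon>' * M \<le> ghat h Rs q} \<le> exp (- ?b)" .
  qed (use Q in auto)
  finally show ?thesis .
qed

text \<open>A bad output forces one of two events: \<open>ghat\<close> underestimates a nearly
  optimal point (\<open>?B1\<close>, governed by \<open>N1\<close>), or it overestimates a net point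
  of small \<open>g\<close> (\<open>?B2\<close>, governed by \<open>N2\<close>).\<close>

lemma prob_final_round_le:
  assumes L: "0 < (real CARD('v))\<^sup>2 * Lh + Ls" and eps: "\<epsilon> < 1 / 2" and LB: "0 < LB" "LB \<le> OPT" and N: "0 < N"
    and \<alpha>: "\<alpha> = 1 / 2 - \<epsilon> / 3"
    and N1: "8 * real CARD('v) * w / (LB * \<alpha>\<^sup>2 * (\<epsilon>\<^sup>2 / 9)) \<le> real N"
    and r: "r = (\<epsilon> / 3) / (((real CARD('v))\<^sup>2 * Lh + Ls) + ((real CARD('v))\<^sup>2 * Lh + Ls)) * LB"
    and N2: "2 * \<alpha> * real CARD('v) * (w + ln (real (covering_number P r)))
               / ((\<epsilon> / 3 - 1 / 4 * \<alpha>\<^sup>2 * (\<epsilon> / 3))\<^sup>2 * LB) \<le> real N"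
  shows "measure_pmf.prob (replicate_pmf N (rr_set Tr)) {Rs. F (A Rs) < (1 / 2 - \<epsilon>) * OPT} \<le> 2 * exp (- w)"
    (is "measure_pmf.prob ?p ?E \<le> _")
proof -
  let ?L = "(real CARD('v))\<^sup>2 * Lh + Ls" and ?K = "real (covering_number P r)"
  have O: "0 < OPT" using opt_ge_1 by simp
  have a: "0 < \<alpha>" "\<alpha> \<le> 1 / 2" using eps eps_pos by (auto simp: \<alpha>)
  have rpos: "0 < r" unfolding r
    by (rule mult_pos_pos[OF divide_pos_pos[OF _ add_pos_pos[OF L L]] LB(1)]) (use eps_pos in simp)
  have K: "1 \<le> ?K" using covering_number_pos[OF P_bounded rpos P_nonempty] by simp
  obtain Q where Q: "finite Q" "Q \<subseteq> closure P" "card Q \<le> covering_number P r"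
    "\<And>x. x \<in> P \<Longrightarrow> \<exists>p\<in>Q. norm (x - p) \<le> r"
    using closure_net[OF P_bounded rpos P_nonempty P_convex] by blast
  \<comment> \<open>The value of \<open>g\<close> at a bad output is below (1/2 - \<epsilon>) times
    \<open>OPT\<close>, and its net point differs by at most \<epsilon>/6 times
    \<open>OPT\<close>.\<close>
  define m where "m = (1 / 2 - 5 * \<epsilon> / 6) * OPT"
  have m: "0 < m" using eps O by (simp add: m_def)
  define Q' where "Q' = {q \<in> Q. g q \<le> m}"
  have "0 < \<epsilon> / 10 * OPT" using eps_pos O by simp
  then obtain z where z: "z \<in> P" "OPT - \<epsilon> / 10 * OPT < F z"
    using near_optimal[of "OPT - \<epsilon> / 10 * OPT"] by auto
  \<comment> \<open>The deviation for which the first sample size, taken at \<open>LB = OPT\<close>,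
    gives failure probability exactly \<open>exp (- w)\<close>.\<close>
  define e where "e = \<alpha> * \<epsilon> / 6 * OPT"
  have e: "0 < e" using a eps_pos O by (simp add: e_def)
  let ?B1 = "{Rs. ghat h Rs z \<le> g z - e}"
  let ?B2 = "{Rs. \<exists>q\<in>Q'. g q + \<epsilon> / 3 * OPT \<le> ghat h Rs q}"

  have B1: "measure_pmf.prob ?p ?B1 \<le> exp (- w)"
  proof -
    have "g z \<le> OPT" using F_le_OPT[OF z(1)] s_nonneg[OF z(1)] by linarith
    hence "measure_pmf.prob ?p ?B1 \<le> exp (- (real N * e\<^sup>2 / (2 * real CARD('v) * OPT)))"
      using P_nonneg[OF z(1)] e O N by (intro prob_ghat_lower_tail) auto
    moreover have "w \<le> real N * e\<^sup>2 / (2 * real CARD('v) * OPT)"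
    proof -
      have "8 * real CARD('v) * w \<le> real N * (LB * \<alpha>\<^sup>2 * (\<epsilon>\<^sup>2 / 9))"
        using N1 LB a eps_pos by (simp add: divide_le_eq)
      also have "\<dots> \<le> real N * (OPT * \<alpha>\<^sup>2 * (\<epsilon>\<^sup>2 / 9))"
        using LB by (intro mult_left_mono mult_right_mono) auto
      finally have "w \<le> real N * (OPT * \<alpha>\<^sup>2 * (\<epsilon>\<^sup>2 / 9)) / (8 * real CARD('v))"
        by (subst pos_le_divide_eq) (simp_all add: mult_ac)
      moreover have "real N * e\<^sup>2 / (2 * real CARD('v) * OPT) = real N * (OPT * \<alpha>\<^sup>2 * (\<epsilon>\<^sup>2 / 9)) / (8 * real CARD('v))"
        using O by (simp add: e_def power2_eq_square)
      ultimately show ?thesis by (simp only:)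
    qed
    ultimately show ?thesis by (meson exp_le_cancel_iff neg_le_iff_le order.trans)
  qed

  have B2: "measure_pmf.prob ?p ?B2 \<le> exp (- w)"
  proof -
    have "measure_pmf.prob ?p ?B2 \<le> ?K * exp (- (w + ln ?K))"
    proof (rule prob_Bex_le)
      show "finite Q'" using Q(1) by (simp add: Q'_def)
      have "card Q' \<le> card Q" using Q(1) by (intro card_mono) (auto simp: Q'_def)
      thus "real (card Q') \<le> ?K" using Q(3) by simp
      fix q assume q: "q \<in> Q'"
      hence qc: "q \<in> closure P" using Q by (auto simp: Q'_def)
      let ?t = "\<epsilon> / 3 * OPT"
      have "measure_pmf.prob ?p {Rs. g q + ?t \<le> ghat h Rs q}
          \<le> exp (- (real N * ?t\<^sup>2 / (real CARD('v) * (2 * m + 2 * ?t / 3))))"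
        using closure_nonneg[OF qc] q m O eps_pos N
        by (intro prob_ghat_upper_tail) (auto simp: Q'_def)
      moreover have "w + ln ?K \<le> real N * ?t\<^sup>2 / (real CARD('v) * (2 * m + 2 * ?t / 3))"
      proof -
        \<comment> \<open>The second sample size is calibrated to the deviation \<open>?e2\<close>;
          being at most \<epsilon>/3, it covers the deviation \<epsilon>/3 used here.\<close>
        let ?e2 = "\<epsilon> / 3 - 1 / 4 * \<alpha>\<^sup>2 * (\<epsilon> / 3)"
        have "\<alpha>\<^sup>2 \<le> 1" using a by (intro power_le_one) auto
        hence "\<alpha>\<^sup>2 * (\<epsilon> / 3) \<le> 1 * (\<epsilon> / 3)" using eps_pos by (intro mult_right_mono) auto
        hence "0 < ?e2" using eps_pos by simp
        moreover have "?e2 \<le> \<epsilon> / 3" using eps_pos by simp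
        ultimately have e2: "0 < ?e2\<^sup>2" "?e2\<^sup>2 \<le> (\<epsilon> / 3)\<^sup>2"
          by - (erule zero_less_power, erule power_mono, erule less_imp_le)
        have "2 * \<alpha> * real CARD('v) * (w + ln ?K) \<le> real N * (?e2\<^sup>2 * LB)"
          using N2 LB(1) e2(1) by (simp add: pos_divide_le_eq)
        also have "\<dots> \<le> real N * ((\<epsilon> / 3)\<^sup>2 * OPT)"
          using e2 LB by (intro mult_left_mono mult_mono) auto
        finally have "w + ln ?K \<le> real N * ((\<epsilon> / 3)\<^sup>2 * OPT) / (2 * \<alpha> * real CARD('v))"
          using a by (simp add: pos_le_divide_eq mult_ac)
        also have "\<dots> = real N * ?t\<^sup>2 / (real CARD('v) * (2 * \<alpha> * OPT))"
          using O by (simp add: power2_eq_square mult_ac)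
        also have "\<dots> \<le> real N * ?t\<^sup>2 / (real CARD('v) * (2 * m + 2 * ?t / 3))"
        proof (intro divide_left_mono mult_left_mono)
          \<comment> \<open>The restriction to \<open>Q'\<close> brings the Bernstein denominator
            below \<open>2 * \<alpha> * OPT\<close>, the factor in the prescribed size.\<close>
          have "2 * m + 2 * ?t / 3 = (1 - 13 * \<epsilon> / 9) * OPT" by (simp add: m_def algebra_simps)
          also have "\<dots> \<le> 2 * \<alpha> * OPT" using eps_pos O by (intro mult_right_mono) (auto simp: \<alpha>)
          finally show "2 * m + 2 * ?t / 3 \<le> 2 * \<alpha> * OPT" .
          have "0 < 2 * m + 2 * ?t / 3" using m O eps_pos by (intro add_pos_pos) auto
          thus "0 < real CARD('v) * (2 * \<alpha> * OPT) * (real CARD('v) * (2 * m + 2 * ?t / 3))"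
            using a O by (intro mult_pos_pos) auto
        qed auto
        finally show ?thesis .
      qed
      ultimately show "measure_pmf.prob ?p {Rs. g q + ?t \<le> ghat h Rs q} \<le> exp (- (w + ln ?K))"
        by (meson exp_le_cancel_iff neg_le_iff_le order.trans)
    qed simp
    also have "\<dots> = exp (- w)" using K by (simp add: exp_diff)
    finally show ?thesis .
  qed

  have "Rs \<in> ?B1 \<union> ?B2" if Rs: "Rs \<in> set_pmf ?p" "F (A Rs) < (1 / 2 - \<epsilon>) * OPT" for Rs
  proof (rule ccontr)
    assume not_bad: "Rs \<notin> ?B1 \<union> ?B2"
    let ?y = "A Rs"
    have "length Rs = N" "set Rs \<subseteq> set_pmf (rr_set Tr)"
      using Rs(1) by (auto simp: set_replicate_pmf in_lists_conv_set)
    hence "0 < inner_beta Lh \<beta>h Rs"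
      using N rr_set_nonempty by (intro inner_beta_pos[OF Lh_or_\<beta>h]) auto
    hence "(ghat h Rs z + s z) / 2 - \<epsilon> / 3 \<le> ghat h Rs ?y + s ?y"
      using inner_result_approx[OF A P_orthant s_concave s_nonneg diam eps_pos] z(1) by blast
    moreover have "g z - e < ghat h Rs z" using not_bad by auto
    moreover have "\<epsilon> / 3 \<le> \<epsilon> / 3 * OPT" using opt_ge_1 eps_pos by simp
    moreover have "e \<le> \<epsilon> / 12 * OPT"
      using a eps_pos O by (auto simp: e_def intro!: mult_right_mono)
    \<comment> \<open>Losses relative to \<open>OPT\<close>: half of the slack \<epsilon>/10 of
      \<open>z\<close>, half of \<open>e\<close>, and \<epsilon>/3 from the inner algorithm.\<close>
    ultimately have "(1 / 2 - (\<epsilon> / 20 + \<epsilon> / 24 + \<epsilon> / 3)) * OPT < ghat h Rs ?y + s ?y"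
      using z(2) by (simp add: field_simps)
    hence dev: "(\<epsilon> - (\<epsilon> / 20 + \<epsilon> / 24 + \<epsilon> / 3)) * OPT < ghat h Rs ?y - g ?y"
      using Rs(2) by (simp add: algebra_simps)
    obtain q where q: "q \<in> Q" "norm (?y - q) \<le> r" using Q(4)[OF A_mem] by blast
    have nonneg: "0 \<le> ?y" "0 \<le> q" using P_nonneg[OF A_mem] q(1) Q(2) closure_nonneg by auto
    have rad: "(real CARD('v))\<^sup>2 * Lh * norm (?y - q) \<le> \<epsilon> / 6 * OPT"
    proof -
      have "(real CARD('v))\<^sup>2 * Lh * norm (?y - q) \<le> ?L * r"
        using q(2) Lh_nonneg Ls_nonneg by (intro mult_mono) auto
      also have "\<dots> = \<epsilon> / 6 * LB"
      proof -
        have "?L * ((\<epsilon> / 6) / ?L * LB) = \<epsilon> / 6 * LB"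
          by (rule mult_divide_mult_cancel) (use L in linarith)
        moreover have "(\<epsilon> / 3) / (?L + ?L) = (\<epsilon> / 6) / ?L" unfolding mult_2[symmetric] by simp
        ultimately show ?thesis by (simp only: r)
      qed
      also have "\<dots> \<le> \<epsilon> / 6 * OPT" using LB eps_pos by (intro mult_left_mono) auto
      finally show ?thesis .
    qed
    have "(ghat h Rs ?y - g ?y) - (ghat h Rs q - g q) \<le> sqrt 2 * ((real CARD('v))\<^sup>2 * Lh) * norm (?y - q)"
      by (rule mono_lipschitz_diff[OF ghat_mono cim_g_mono ghat_lipschitz cim_g_lipschitz nonneg])
    also have "\<dots> = sqrt 2 * ((real CARD('v))\<^sup>2 * Lh * norm (?y - q))" by simp
    also have "\<dots> \<le> 1.42 * (\<epsilon> / 6 * OPT)"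
    proof (rule mult_mono[OF _ rad])
      show "sqrt 2 \<le> 1.42" by (rule real_le_lsqrt) (auto simp: power2_eq_square)
    qed (use Lh_nonneg in auto)
    finally have net: "(ghat h Rs ?y - g ?y) - (ghat h Rs q - g q) \<le> 1.42 * (\<epsilon> / 6 * OPT)" .
    have "0 < \<epsilon> * OPT" using eps_pos O by simp
    \<comment> \<open>Of \<epsilon> there remain 23/40 by \<open>dev\<close>, and moving to the net
      point costs 1.42/6, which leaves slightly more than 1/3. With the factor 2 instead of
      \<open>sqrt 2\<close> less than 1/4 would be left.\<close>
    with dev net have "g q + \<epsilon> / 3 * OPT \<le> ghat h Rs q" by (simp add: field_simps)
    moreover have "g q \<le> m"
    proof -
      have "g q - g ?y \<le> (real CARD('v))\<^sup>2 * Lh * norm (?y - q)"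
        using lipschitz_on_normD[OF cim_g_lipschitz[of Tr], of ?y q] nonneg by auto
      with rad Rs(2) s_nonneg[OF A_mem[of Rs]] show ?thesis
        by (simp add: m_def field_simps)
    qed
    ultimately have "Rs \<in> ?B2" using q(1) by (auto simp: Q'_def)
    with not_bad show False by blast
  qed
  hence "measure_pmf.prob ?p ?E \<le> measure_pmf.prob ?p (?B1 \<union> ?B2)"
    by (intro measure_pmf.finite_measure_mono_AE) (auto simp: AE_measure_pmf_iff)
  also have "\<dots> \<le> measure_pmf.prob ?p ?B1 + measure_pmf.prob ?p ?B2"
    by (rule measure_Un_le) auto
  finally show ?thesis using B1 B2 by simp
qed

end

section \<open>The approximation guarantee: degenerate cases and the sum of the two failure
  probabilities\<close>

theorem theorem3:
  fixes E :: "('v::finite \<times> 'v) set"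
    and Tr :: "'v \<Rightarrow> 'v set pmf"
    and h :: "'v \<Rightarrow> real ^ 'd \<Rightarrow> real"
    and D :: "(real ^ 'd) set"
    and c :: "real ^ 'd \<Rightarrow> real"
    and k lam Lh \<beta>h Lc \<Delta> \<epsilon> l :: real
    and A :: "'v set list \<Rightarrow> real ^ 'd"
  defines "P \<equiv> feasible D c k"
    and "s \<equiv> cim_s lam k c"
    and "F \<equiv> (\<lambda>x. cim_g Tr h x + cim_s lam k c x)"
  assumes "\<And>v. set_pmf (Tr v) \<subseteq> Pow {u. (u, v) \<in> E}"
    and "convex D" and "D \<subseteq> {0..}"
    and "\<And>v x. x \<in> {0..} \<Longrightarrow> h v x \<in> {0..1}"
    and "\<And>v. mono_on {0..} (h v)"
    and "\<And>v. dr_submodular (h v)"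
    and "\<And>v. Lh-lipschitz_on {0..} (h v)"
    and "\<And>v. smooth \<beta>h (h v)"
    and "0 < Lh \<or> 0 < \<beta>h"
    and "convex_on D c"
    and "Lc-lipschitz_on D c"
    and "0 \<le> k" and "0 \<le> lam"
    and "\<And>x y. x \<in> P \<Longrightarrow> y \<in> P \<Longrightarrow> norm (x - y) \<le> \<Delta>"
    and "0 < \<epsilon>" and "0 < l"
    and "\<And>Rs. inner_result P s h Lh \<beta>h \<Delta> \<epsilon> Rs (A Rs)"
    and "1 \<le> cim_opt P F"
  shows "measure_pmf.prob (prox_grad_ris Tr h D c k lam Lh Lc \<epsilon> l A)
           {x \<in> P. F x \<ge> (1 / 2 - \<epsilon>) * cim_opt P F}
         \<ge> 1 - 1 / real CARD('v) powr l"
proof -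
  let ?n = "real CARD('v)"
  let ?L = "?n\<^sup>2 * Lh + lam * Lc"
  let ?out = "prox_grad_ris Tr h D c k lam Lh Lc \<epsilon> l A"
  have conv_P: "convex P"
    unfolding convex_alt
  proof safe
    fix x y :: "real ^ 'd" and u :: real
    assume x: "x \<in> P" and y: "y \<in> P" and u: "0 \<le> u" "u \<le> 1"
    have xD: "x \<in> D" "c x \<le> k" and yD: "y \<in> D" "c y \<le> k"
      using x y by (auto simp: P_def feasible_def)
    have "c ((1 - u) *\<^sub>R x + u *\<^sub>R y) \<le> (1 - u) * c x + u * c y"
      by (rule convex_onD[OF \<open>convex_on D c\<close> u xD(1) yD(1)])
    also have "\<dots> \<le> (1 - u) * k + u * k"
      using xD yD u by (intro add_mono mult_left_mono) auto
    finally have "c ((1 - u) *\<^sub>R x + u *\<^sub>R y) \<le> k" by (simp add: algebra_simps)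
    moreover have "(1 - u) *\<^sub>R x + u *\<^sub>R y \<in> D"
      using convexD_alt[OF \<open>convex D\<close> xD(1) yD(1) u] .
    ultimately show "(1 - u) *\<^sub>R x + u *\<^sub>R y \<in> P" by (simp add: P_def feasible_def)
  qed
  have PD: "P \<subseteq> D" by (auto simp: P_def feasible_def)
  interpret proximal_ris h Lh \<beta>h Tr P s "lam * Lc" \<Delta> \<epsilon> A
  proof
    show "P \<subseteq> {0..}" using PD \<open>D \<subseteq> {0..}\<close> by blast
    have "convex_on P (\<lambda>x. lam * c x + (- (lam * k)))"
      using convex_on_subset[OF \<open>convex_on D c\<close> PD conv_P] \<open>0 \<le> lam\<close> conv_P
      by (intro convex_on_add convex_on_cmul) (auto simp: convex_on_const)
    thus "concave_on P s" by (simp add: concave_on_def s_def cim_s_def[abs_def] algebra_simps)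
    show "0 \<le> s x" if "x \<in> P" for x
      using that \<open>0 \<le> lam\<close> by (simp add: s_def cim_s_def P_def feasible_def)
    have "(lam * (0 + Lc))-lipschitz_on P (\<lambda>x. lam * (k - c x))"
      using lipschitz_on_subset[OF \<open>Lc-lipschitz_on D c\<close> PD] \<open>0 \<le> lam\<close>
      by (intro lipschitz_on_cmult_real_nonneg lipschitz_on_diff lipschitz_on_constant)
    thus "(lam * Lc)-lipschitz_on P s" by (simp add: s_def cim_s_def[abs_def])
    show "1 \<le> cim_opt P (\<lambda>x. cim_g Tr h x + s x)" using assms by simp
  qed (use assms in auto)
  have F_eq: "F = (\<lambda>x. cim_g Tr h x + s x)" by (simp add: F_def s_def)
  have F_ge_0: "0 \<le> F x" if "x \<in> P" for x
    using F_nonneg[OF that] by (simp add: F_eq)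
  have opt: "1 \<le> cim_opt P F" by fact
  have supp: "set_pmf ?out \<subseteq> range A"
    by (auto simp: prox_grad_ris_def Let_def)
  have sure: "1 - 1 / ?n powr l \<le> measure_pmf.prob ?out {x \<in> P. (1 / 2 - \<epsilon>) * cim_opt P F \<le> F x}"
    if "\<And>x. x \<in> P \<Longrightarrow> (1 / 2 - \<epsilon>) * cim_opt P F \<le> F x"
  proof -
    have "measure_pmf.prob ?out {x \<in> P. (1 / 2 - \<epsilon>) * cim_opt P F \<le> F x} = 1"
      using supp A_mem that by (auto simp: measure_pmf.prob_eq_1 AE_measure_pmf_iff)
    thus ?thesis by simp
  qed
  have Lc: "0 \<le> Lc" using \<open>Lc-lipschitz_on D c\<close> by (rule lipschitz_on_nonneg)
  \<comment> \<open>One node allows failure probability 1, and \<epsilon> at least 1/2 makes the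
    approximation factor nonpositive. Excluding both gives \<open>1 \<le> log 2 B\<close> and the
    bound on \<epsilon> that the final round requires.\<close>
  consider "CARD('v) = 1" | "1 / 2 \<le> \<epsilon>" | "?L = 0"
    | "CARD('v) \<noteq> 1" "\<epsilon> < 1 / 2" "?L \<noteq> 0" by linarith
  thus ?thesis
  proof cases
    case 1
    thus ?thesis by simp
  next
    case 2
    have neg: "(1 / 2 - \<epsilon>) * cim_opt P F \<le> 0" using 2 opt by (intro mult_nonpos_nonneg) auto
    show ?thesis by (rule sure) (rule order.trans[OF neg F_ge_0])
  next
    (* here the net radii degenerate to 0, where the covering number of an infinite P is a junk value *)
    case 3
    show ?thesis
    proof (rule sure)
      fix x assume x: "x \<in> P"
      have "F y \<le> F x" if "y \<in> P" for y
        using lipschitz_on_normD[OF F_lipschitz that x] 3 by (simp add: F_eq)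
      hence "cim_opt P F \<le> F x" unfolding cim_opt_def using P_nonempty by (intro cSUP_least) auto
      moreover have "(1 / 2 - \<epsilon>) * cim_opt P F \<le> 1 * cim_opt P F"
        using opt \<open>0 < \<epsilon>\<close> by (intro mult_right_mono) auto
      ultimately show "(1 / 2 - \<epsilon>) * cim_opt P F \<le> F x" by simp
    qed
  next
    case 4
    define B where "B = ?n + lam * k"
    define \<epsilon>' where "\<epsilon>' = sqrt 2 * \<epsilon> / 3"
    define \<kappa> where "\<kappa> = 1 + sqrt 2 * \<epsilon> / 3 + \<epsilon> / 3"
    define \<theta> where "\<theta> = search_size ?n P ?L B \<epsilon> l"
    define R where "R = nat \<lfloor>log 2 B - 1\<rfloor>"
    define S where "S = search (rr_set Tr) A (\<lambda>Rs x. ghat h Rs x + s x) \<theta> (\<lambda>i. B / 2 ^ i) \<kappa> 1 R []"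
    define good where "good = (\<lambda>LB. 0 < LB \<and> LB \<le> cim_opt P F)"
    have L: "0 < ?L" using 4(3) Lh_nonneg Ls_nonneg by (simp add: order.not_eq_order_implies_strict)
    have "0 < CARD('v)" by simp
    with 4(1) have n: "2 \<le> ?n" by linarith
    have "0 \<le> lam * k" using \<open>0 \<le> lam\<close> \<open>0 \<le> k\<close> by simp
    hence B: "2 \<le> B" using n by (simp add: B_def)
    have logB: "1 \<le> log 2 B" using B by (simp add: le_log_iff)
    have e': "0 < \<epsilon>'" using \<open>0 < \<epsilon>\<close> by (simp add: \<epsilon>'_def)
    have nl: "0 < ?n powr l" using n by simp
    have rad: "0 < (\<epsilon> / 3) / ?L * (B / 2 ^ i)" for i
      using \<open>0 < \<epsilon>\<close> L B by simp
    define K where "K i = real (covering_number P ((\<epsilon> / 3) / ?L * (B / 2 ^ i)))" for i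
    \<comment> \<open>Chosen so that \<open>K i * exp (- W i)\<close> equals
      \<open>1 / (2 * ?n powr l * log 2 B)\<close>: half of the allowed failure probability, shared
      among at most \<open>log 2 B\<close> rounds.\<close>
    define W where "W i = ln (K i) + l * ln ?n + ln 2 + ln (log 2 B)" for i
    have cov: "1 \<le> K i" for i
      using covering_number_pos[OF P_bounded rad P_nonempty] by (simp add: K_def)
    have W_pos: "0 < W i" for i
    proof -
      have "0 \<le> ln (K i)" using cov by simp
      moreover have "0 \<le> l * ln ?n" using n \<open>0 < l\<close> by simp
      moreover have "0 \<le> ln (log 2 B)" using logB by simp
      moreover have "(0 :: real) < ln 2" by simp
      ultimately show ?thesis unfolding W_def by linarith
    qed
    have \<theta>: "\<theta> i = nat \<lceil>?n * (2 + 2 / 3 * \<epsilon>') * W i / (\<epsilon>'\<^sup>2 * (B / 2 ^ i))\<rceil>" if "1 \<le> i" for i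
    proof -
      have "i \<noteq> 0" using that by simp
      thus ?thesis by (simp only: \<theta>_def search_size_def W_def K_def \<epsilon>'_def Let_def if_False)
    qed
    have \<theta>_ge: "?n * (2 + 2 / 3 * \<epsilon>') * W i / (\<epsilon>'\<^sup>2 * (B / 2 ^ i)) \<le> real (\<theta> i)" if "1 \<le> i" for i
      unfolding \<theta>[OF that] by (rule real_nat_ceiling_ge)
    have \<theta>_pos: "0 < \<theta> i" if "1 \<le> i" for i
    proof -
      have "0 < ?n * (2 + 2 / 3 * \<epsilon>') * W i / (\<epsilon>'\<^sup>2 * (B / 2 ^ i))"
        using n e' W_pos B by (intro divide_pos_pos mult_pos_pos add_pos_pos) auto
      with \<theta>_ge[OF that] show ?thesis by linarith
    qed
    \<comment> \<open>A smaller guess shrinks the net radius, so the covering number and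
      \<open>W\<close> grow while the denominator falls; for the first round the predecessor is
      \<open>\<theta> 0 = 0\<close>.\<close>
    have \<theta>_mono: "\<theta> (i - 1) \<le> \<theta> i" if "1 \<le> i" for i
    proof (cases "i = 1")
      case True
      thus ?thesis by (simp add: \<theta>_def search_size_def)
    next
      case False
      then obtain j where j: "i = Suc j" "1 \<le> j" using \<open>1 \<le> i\<close> by (cases i) auto
      have ji: "j \<le> i" using j by simp
      have half: "B / 2 ^ i \<le> B / 2 ^ j" using B by (simp add: j field_simps)
      have "(\<epsilon> / 3) / ?L * (B / 2 ^ i) \<le> (\<epsilon> / 3) / ?L * (B / 2 ^ j)"
        using half \<open>0 < \<epsilon>\<close> L by (intro mult_left_mono) auto
      hence "K j \<le> K i"
        unfolding K_def using covering_number_antimono[OF P_bounded rad] by (simp only: of_nat_le_iff)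
      hence "W j \<le> W i"
        using cov[of j] unfolding W_def by simp
      hence step: "?n * (2 + 2 / 3 * \<epsilon>') * W j / (\<epsilon>'\<^sup>2 * (B / 2 ^ j))
          \<le> ?n * (2 + 2 / 3 * \<epsilon>') * W i / (\<epsilon>'\<^sup>2 * (B / 2 ^ i))"
        using n e' W_pos[of i] W_pos[of j] B half ji
        by (intro frac_le mult_left_mono mult_nonneg_nonneg mult_pos_pos) (auto simp: less_imp_le)
      have "\<theta> j \<le> \<theta> i"
        unfolding \<theta>[OF j(2)] \<theta>[OF that] by (rule nat_mono[OF ceiling_mono[OF step]])
      thus ?thesis by (simp add: j(1))
    qed

    have S_bad: "measure_pmf.prob S {LB. \<not> good LB} \<le> 1 / (2 * ?n powr l)"
    proof -
      let ?E = "\<lambda>i. {Rs. \<kappa> * (B / 2 ^ i) \<le> ghat h Rs (A Rs) + s (A Rs)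
                         \<and> \<not> good ((ghat h Rs (A Rs) + s (A Rs)) / \<kappa>)}"
      have round: "measure_pmf.prob (replicate_pmf (\<theta> i) (rr_set Tr)) (?E i) \<le> 1 / (2 * ?n powr l * log 2 B)"
        if i: "1 \<le> i" for i
      proof -
        have x: "0 < B / 2 ^ i" using B by simp
        have "W i \<le> real (\<theta> i) * (\<epsilon>'\<^sup>2 * (B / 2 ^ i)) / (?n * (2 + 2 / 3 * \<epsilon>'))"
        proof -
          have "0 < \<epsilon>'\<^sup>2 * (B / 2 ^ i)" by (rule mult_pos_pos[OF zero_less_power[OF e'] x])
          moreover have "0 < ?n * (2 + 2 / 3 * \<epsilon>')" by (rule mult_pos_pos) (use n e' in auto)
          ultimately show ?thesis using \<theta>_ge[OF i]
            by (simp only: pos_divide_le_eq pos_le_divide_eq mult.commute)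
        qed
        hence "K i * exp (- (real (\<theta> i) * (\<epsilon>'\<^sup>2 * (B / 2 ^ i)) / (?n * (2 + 2 / 3 * \<epsilon>')))) \<le> K i * exp (- W i)"
          using cov[of i] by (intro mult_left_mono) auto
        with prob_search_round_le[OF L x \<theta>_pos[OF i] \<epsilon>'_def \<kappa>_def]
        have "measure_pmf.prob (replicate_pmf (\<theta> i) (rr_set Tr)) (?E i) \<le> K i * exp (- W i)"
          unfolding good_def F_eq K_def by (rule order.trans)
        also have "exp (- W i) = 1 / (K i * ?n powr l * 2 * log 2 B)"
        proof -
          have "exp (W i) = K i * ?n powr l * 2 * log 2 B"
            using cov[of i] n logB unfolding W_def by (simp add: exp_add powr_def)
          thus ?thesis by (simp add: exp_minus inverse_eq_divide)
        qed
        also have "K i * (1 / (K i * ?n powr l * 2 * log 2 B)) = 1 / (2 * ?n powr l * log 2 B)" using cov[of i] by simp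
        finally show ?thesis .
      qed
      have S_eq: "S = replicate_pmf (\<theta> (1 - 1)) (rr_set Tr)
          \<bind> search (rr_set Tr) A (\<lambda>Rs x. ghat h Rs x + s x) \<theta> (\<lambda>i. B / 2 ^ i) \<kappa> 1 R"
        by (simp add: S_def \<theta>_def search_size_def bind_return_pmf)
      have "measure_pmf.prob S {LB. \<not> good LB}
          \<le> (\<Sum>i\<in>{1..<1 + R}. measure_pmf.prob (replicate_pmf (\<theta> i) (rr_set Tr)) (?E i))"
        unfolding S_eq by (rule prob_search_le) (use \<theta>_mono opt in \<open>auto simp: good_def\<close>)
      also have "\<dots> \<le> (\<Sum>i\<in>{1..<1 + R}. 1 / (2 * ?n powr l * log 2 B))"
        by (intro sum_mono round) auto
      also have "\<dots> = real R * (1 / (2 * ?n powr l * log 2 B))" by simp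
      also have "\<dots> \<le> log 2 B * (1 / (2 * ?n powr l * log 2 B))"
      proof (rule mult_right_mono)
        show "real R \<le> log 2 B" using logB unfolding R_def by linarith
      qed (use logB nl in simp)
      also have "\<dots> = 1 / (2 * ?n powr l)" using logB by simp
      finally show ?thesis .
    qed

    have final: "measure_pmf.prob (replicate_pmf (final_size ?n P ?L ?L \<epsilon> l LB) (rr_set Tr) \<bind> (\<lambda>Rs. return_pmf (A Rs)))
        {x. \<not> (1 / 2 - \<epsilon>) * cim_opt P F \<le> F x} \<le> 1 / (2 * ?n powr l)" if "good LB" for LB
    proof -
      have LB: "0 < LB" "LB \<le> cim_opt P F" using that by (auto simp: good_def)
      define \<alpha> where "\<alpha> = 1 / 2 - \<epsilon> / 3"
      define r where "r = (\<epsilon> / 3) / (?L + ?L) * LB"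
      define w where "w = ln (4 * ?n powr l)"
      define N where "N = final_size ?n P ?L ?L \<epsilon> l LB"
      have rpos: "0 < r" unfolding r_def
        by (rule mult_pos_pos[OF divide_pos_pos[OF _ add_pos_pos[OF L L]] LB(1)]) (use \<open>0 < \<epsilon>\<close> in simp)
      have K: "1 \<le> real (covering_number P r)"
        using covering_number_pos[OF P_bounded rpos P_nonempty] by simp
      have "1 \<le> ?n powr l" using n \<open>0 < l\<close> by (simp add: ge_one_powr_ge_zero)
      hence w: "0 < w" unfolding w_def by simp
      define \<theta>1 where "\<theta>1 = 8 * ?n * w / (LB * \<alpha>\<^sup>2 * (\<epsilon>\<^sup>2 / 9))"
      define \<theta>2 where "\<theta>2 = 2 * \<alpha> * ?n * (w + ln (real (covering_number P r)))
               / ((\<epsilon> / 3 - 1 / 4 * \<alpha>\<^sup>2 * (\<epsilon> / 3))\<^sup>2 * LB)"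
      have "ln (4 * ?n powr l * real (covering_number P r)) = w + ln (real (covering_number P r))"
        unfolding w_def using K nl by (subst ln_mult_pos) auto
      hence N_eq: "N = nat \<lceil>max \<theta>1 \<theta>2\<rceil>"
        by (simp only: N_def final_size_def Let_def \<theta>1_def \<theta>2_def w_def \<alpha>_def r_def)
      have "max \<theta>1 \<theta>2 \<le> real N" unfolding N_eq by (rule real_nat_ceiling_ge)
      hence N1: "\<theta>1 \<le> real N" and N2: "\<theta>2 \<le> real N" by simp_all
      have "0 < \<alpha>" using 4(2) by (simp add: \<alpha>_def)
      hence "0 < \<theta>1" unfolding \<theta>1_def using n w LB(1) \<open>0 < \<epsilon>\<close> by simp
      hence Npos: "0 < N" using N1 by simp
      have "measure_pmf.prob (replicate_pmf N (rr_set Tr)) {Rs. F (A Rs) < (1 / 2 - \<epsilon>) * cim_opt P F}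
          \<le> 2 * exp (- w)"
        using prob_final_round_le[OF L 4(2) LB(1) LB(2)[unfolded F_eq] Npos \<alpha>_def N1[unfolded \<theta>1_def] r_def
            N2[unfolded \<theta>2_def]]
        by (simp only: F_eq)
      also have "2 * exp (- w) = 1 / (2 * ?n powr l)"
        using nl by (simp add: w_def exp_minus inverse_eq_divide)
      finally show ?thesis
        unfolding N_def[symmetric] map_pmf_def[symmetric]
        by (simp add: vimage_def not_le)
    qed

    have "?out = S \<bind> (\<lambda>LB. replicate_pmf (final_size ?n P ?L ?L \<epsilon> l LB) (rr_set Tr) \<bind> (\<lambda>Rs. return_pmf (A Rs)))"
      by (simp only: prox_grad_ris_def Let_def S_def \<theta>_def R_def B_def \<kappa>_def s_def P_def)
    \<comment> \<open>The comparison computation has the empty set as bad event and contributes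
      0.\<close>
    hence "measure_pmf.prob ?out {x. \<not> (1 / 2 - \<epsilon>) * cim_opt P F \<le> F x}
        \<le> measure_pmf.prob S {LB. \<not> good LB}
          + (measure_pmf.prob (S \<bind> (\<lambda>LB. return_pmf LB)) {} + 1 / (2 * ?n powr l))"
      using prob_bind_pmf_le[of S "{LB. \<not> good LB}" _ "{x. \<not> (1 / 2 - \<epsilon>) * cim_opt P F \<le> F x}"
          return_pmf "{}" "1 / (2 * ?n powr l)"] final nl by simp
    hence bad: "measure_pmf.prob ?out {x. \<not> (1 / 2 - \<epsilon>) * cim_opt P F \<le> F x} \<le> 1 / ?n powr l"
      using S_bad by simp
    have "1 - measure_pmf.prob ?out {x. \<not> (1 / 2 - \<epsilon>) * cim_opt P F \<le> F x}
        = measure_pmf.prob ?out {x. (1 / 2 - \<epsilon>) * cim_opt P F \<le> F x}"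
      using measure_pmf.prob_compl[of "{x. \<not> (1 / 2 - \<epsilon>) * cim_opt P F \<le> F x}" ?out]
      by (simp add: Compl_eq_Diff_UNIV[symmetric] Collect_neg_eq[symmetric])
    also have "\<dots> \<le> measure_pmf.prob ?out {x \<in> P. (1 / 2 - \<epsilon>) * cim_opt P F \<le> F x}"
      by (rule measure_pmf.finite_measure_mono_AE) (use supp A_mem in \<open>auto simp: AE_measure_pmf_iff\<close>)
    finally show ?thesis using bad by linarith
  qed
qed

end
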